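(* Let $A_h$ and $B_h$ commute, i.e. $A_hB_h=B_hA_h$. Let either $\sigma\ge\frac14$ and $\varepsilon_0=1$, or $$\sigma<\tfrac14,\qquad \big(\tfrac14-\sigma\big)h_t^2\alpha_h^2\le(1-\varepsilon_0^2)\underline{\rho}\quad\text{for some }0<\varepsilon_0<1,$$ where in the case $\sigma<\frac14$ the number $\alpha_h$ is such that $\|w\|_{A_h}\le\alpha_h\|w\|_{B_h}$ for all $w\in H_h$. Let $v:\overline\omega_{h_t}\to H_h$ be the solution to the three-level method $$B_h(\rho\Lambda_tv)+\sigma h_t^2A_h\Lambda_tv+A_hv=f\quad\text{in }H_h\text{ on }\omega_{h_t},$$ $$B_h(\rho\delta_tv^0)+\sigma h_t^2A_h\delta_tv^0+\tfrac12h_tA_hv^0=u_1+\tfrac12h_tf^0\quad\text{in }H_h,$$ with given $v^0,u_1\in H_h$ and $f:\{t_m\}_{m=0}^{M-1}\to H_h$. Then the following bounds hold. (1) In the strong energy norm: $$\max_{1\le m\le M}\Big[\|\sqrt\rho\,\bar\delta_tv^m\|_h^2+(\sigma-\tfrac14)h_t^2\|\bar\delta_tv^m\|_{B_h^{-1}A_h}^2+\|\bar s_tv^m\|_{B_h^{-1}A_h}^2\Big]^{1/2}$$ $$\le\Big(\|v^0\|_{B_h^{-1}A_h}^2+\varepsilon_0^{-2}\big\|\tfrac1{\sqrt\rho}B_h^{-1}u_1\big\|_h^2\Big)^{1/2}+2\varepsilon_0^{-1}\big\|\tfrac1{\sqrt\rho}B_h^{-1}f\big\|_{L^1_{h_t}(H_h)},$$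 where the last ($f$-)term can be replaced with $$2I_{h_t}^{M-1}\|(A_hB_h)^{-1/2}\bar\delta_tf\|_h+3\max_{0\le m\le M-1}\|(A_hB_h)^{-1/2}f^m\|_h.$$ (2) In the weak energy norm: $$\max_{0\le m\le M}\max\Big\{\Big[\|\sqrt\rho\,v^m\|_h^2+(\sigma-\tfrac14)h_t^2\|v^m\|_{B_h^{-1}A_h}^2\Big]^{1/2},\ \|I_{h_t}^m\bar s_tv\|_{B_h^{-1}A_h}\Big\}$$ $$\le\Big[\|\sqrt\rho\,v^0\|_h^2+(\sigma-\tfrac14)h_t^2\|v^0\|_{B_h^{-1}A_h}^2\Big]^{1/2}+2\|(A_hB_h)^{-1/2}u_1\|_h+2\|(A_hB_h)^{-1/2}f\|_{L^1_{h_t}(H_h)},$$ where, if $f=\delta_tg$ on $\{t_m\}_{m=0}^{M-1}$ for some $g:\overline\omega_{h_t}\to H_h$, the last ($f$-)term can be replaced with $2\varepsilon_0^{-1}I_{h_t}^{M}\big\|\tfrac1{\sqrt\rho}B_h^{-1}(g-s_tg^0)\big\|_h$.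
   Context: $H_h$ is a (finite-dimensional) Euclidean space of functions given on a spatial mesh, with inner product $(\cdot,\cdot)_h$ (a mesh $L^2$-type inner product, so that multiplication by a real mesh function is self-adjoint) and norm $\|\cdot\|_h$. The function $\rho=\rho(x)$ is given with $0<\underline\rho\le\rho(x)$, where $\underline\rho$ is a constant; $\rho w$, $\sqrt\rho\,w$, $\frac1{\sqrt\rho}w$ denote pointwise multiplication. $A_h,B_h$ are linear operators in $H_h$ with $A_h=A_h^*>0$, $B_h=B_h^*>0$. For any operator $C_h=C_h^*>0$ in $H_h$, $\|w\|_{C_h}:=(C_hw,w)_h^{1/2}$. The parameter $\sigma$ is real (it may depend on the mesh parameters). Time mesh: $\overline\omega_{h_t}=\{t_m=mh_t\}_{m=0}^M$ on $[0,T]$, $h_t=T/M>0$, $M\ge2$; $\omega_{h_t}=\{t_m\}_{m=1}^{M-1}$. For functions $y$ on the time mesh, $y^m=y(t_m)$, $\check y^m=y^{m-1}$, $\hat y^m=y^{m+1}$, and $$\bar s_ty=\tfrac{\check y+y}2,\quad s_ty=\tfrac{y+\hat y}2,\quad\bar\delta_ty=\tfrac{y-\check y}{h_t},\quad\delta_ty=\tfrac{\hat y-y}{h_t},\quad\Lambda_ty=\tfrac{\hat y-2y+\check y}{h_t^2}.$$ Here $\delta_tv^0=(\delta_tv)^0$, $s_tg^0=(s_tg)^0$, etc. Also $I_{h_t}^my=h_t\sum_{l=1}^my^l$ for $1\le m\le M$, $I_{h_t}^0y=0$, and $\|y\|_{L^1_{h_t}(H_h)}:=\frac14h_t\|y^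0\|_h+I_{h_t}^{M-1}\|y\|_h$.
   Formalization: In (2), the L¹ bound for ‖I^m s̄_t v‖ gets an extra term ½h_t‖(A_hB_h)^{-1/2}f⁰‖_h, since as printed it fails (one mesh point, ρ=A_h=B_h=1, σ=¼, h_t=4, M=2, v⁰=u_1=0, f⁰=1, f¹=0: 16/5 > 2); all else is literal. *)

theory Defs
  imports "HOL-Analysis.Analysis"
begin

text \<open>
  The spatial mesh is a finite type \<open>'x\<close> and mesh functions are vectors of type \<open>real ^ 'x\<close>;
  the product \<open>*\<close> on this type is the pointwise one.
\<close>

text \<open>
  The last condition is what makes the inner product of mesh $L^2$ type: multiplication by any
  real mesh function is self-adjoint.  The scalar product need not be the
  built-in one of \<open>real ^ 'x\<close>.
\<close>

definition mesh_inner :: "(real ^ 'x \<Rightarrow> real ^ 'x \<Rightarrow> real) \<Rightarrow> bool" where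
  "mesh_inner ip \<longleftrightarrow> bilinear ip \<and> (\<forall>u w. ip u w = ip w u) \<and> (\<forall>w. w \<noteq> 0 \<longrightarrow> 0 < ip w w) \<and>
     (\<forall>a u w. ip (a * u) w = ip u (a * w))"

definition mesh_norm :: "(real ^ 'x \<Rightarrow> real ^ 'x \<Rightarrow> real) \<Rightarrow> real ^ 'x \<Rightarrow> real" where
  "mesh_norm ip w = sqrt (ip w w)"

definition sqrt_fun :: "real ^ 'x \<Rightarrow> real ^ 'x" where
  "sqrt_fun r = (\<chi> x. sqrt (r $ x))"

definition inv_sqrt_fun :: "real ^ 'x \<Rightarrow> real ^ 'x" where
  "inv_sqrt_fun r = (\<chi> x. 1 / sqrt (r $ x))"

definition pos_selfadjoint ::
    "(real ^ 'x \<Rightarrow> real ^ 'x \<Rightarrow> real) \<Rightarrow> (real ^ 'x \<Rightarrow> real ^ 'x) \<Rightarrow> bool" where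
  "pos_selfadjoint ip C \<longleftrightarrow> linear C \<and> (\<forall>u w. ip (C u) w = ip u (C w)) \<and>
     (\<forall>w. w \<noteq> 0 \<longrightarrow> 0 < ip (C w) w)"

definition op_norm ::
    "(real ^ 'x \<Rightarrow> real ^ 'x \<Rightarrow> real) \<Rightarrow> (real ^ 'x \<Rightarrow> real ^ 'x) \<Rightarrow> real ^ 'x \<Rightarrow> real" where
  "op_norm ip C w = sqrt (ip (C w) w)"

definition op_sqrt ::
    "(real ^ 'x \<Rightarrow> real ^ 'x \<Rightarrow> real) \<Rightarrow> (real ^ 'x \<Rightarrow> real ^ 'x) \<Rightarrow> real ^ 'x \<Rightarrow> real ^ 'x" where
  "op_sqrt ip C = (THE S. pos_selfadjoint ip S \<and> S \<circ> S = C)"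

definition op_inv_sqrt ::
    "(real ^ 'x \<Rightarrow> real ^ 'x \<Rightarrow> real) \<Rightarrow> (real ^ 'x \<Rightarrow> real ^ 'x) \<Rightarrow> real ^ 'x \<Rightarrow> real ^ 'x" where
  "op_inv_sqrt ip C = inv (op_sqrt ip C)"

text \<open>
  A function \<open>y\<close> on the time mesh is represented by \<open>m \<mapsto> y m\<close>, its value at \<open>t\<^sub>m = m h\<^sub>t\<close>.
  The backward operators are meaningful for \<open>m \<ge> 1\<close> only, as is the second difference.
\<close>

definition sbar_t :: "(nat \<Rightarrow> 'v::real_vector) \<Rightarrow> nat \<Rightarrow> 'v" where
  "sbar_t y m = (1 / 2) *\<^sub>R (y (m - 1) + y m)"

definition s_t :: "(nat \<Rightarrow> 'v::real_vector) \<Rightarrow> nat \<Rightarrow> 'v" where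
  "s_t y m = (1 / 2) *\<^sub>R (y m + y (m + 1))"

definition dbar_t :: "real \<Rightarrow> (nat \<Rightarrow> 'v::real_vector) \<Rightarrow> nat \<Rightarrow> 'v" where
  "dbar_t ht y m = (1 / ht) *\<^sub>R (y m - y (m - 1))"

definition d_t :: "real \<Rightarrow> (nat \<Rightarrow> 'v::real_vector) \<Rightarrow> nat \<Rightarrow> 'v" where
  "d_t ht y m = (1 / ht) *\<^sub>R (y (m + 1) - y m)"

definition Lambda_t :: "real \<Rightarrow> (nat \<Rightarrow> 'v::real_vector) \<Rightarrow> nat \<Rightarrow> 'v" where
  "Lambda_t ht y m = (1 / ht\<^sup>2) *\<^sub>R (y (m + 1) - 2 *\<^sub>R y m + y (m - 1))"

definition I_t :: "real \<Rightarrow> nat \<Rightarrow> (nat \<Rightarrow> 'v::real_vector) \<Rightarrow> 'v" where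
  "I_t ht m y = ht *\<^sub>R (\<Sum>l = 1..m. y l)"

definition L1_norm ::
    "(real ^ 'x \<Rightarrow> real ^ 'x \<Rightarrow> real) \<Rightarrow> real \<Rightarrow> nat \<Rightarrow> (nat \<Rightarrow> real ^ 'x) \<Rightarrow> real" where
  "L1_norm ip ht M y = 1 / 4 * ht * mesh_norm ip (y 0) + I_t ht (M - 1) (\<lambda>l. mesh_norm ip (y l))"

definition three_level_method ::
    "(real ^ 'x \<Rightarrow> real ^ 'x) \<Rightarrow> (real ^ 'x \<Rightarrow> real ^ 'x) \<Rightarrow> real ^ 'x \<Rightarrow> real \<Rightarrow> real \<Rightarrow> nat \<Rightarrow>
     (nat \<Rightarrow> real ^ 'x) \<Rightarrow> real ^ 'x \<Rightarrow> (nat \<Rightarrow> real ^ 'x) \<Rightarrow> bool" where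
  "three_level_method A B \<rho> \<sigma> ht M f u1 v \<longleftrightarrow>
     (\<forall>m \<in> {1..M - 1}. B (\<rho> * Lambda_t ht v m) + (\<sigma> * ht\<^sup>2) *\<^sub>R A (Lambda_t ht v m) + A (v m) = f m) \<and>
     B (\<rho> * d_t ht v 0) + (\<sigma> * ht\<^sup>2) *\<^sub>R A (d_t ht v 0) + (ht / 2) *\<^sub>R A (v 0) = u1 + (ht / 2) *\<^sub>R f 0"

text \<open>
  In the next two definitions \<open>K\<close> is to be $B_h^{-1}A_h$.  For \<open>\<sigma> < 1/4\<close> the terms with
  \<open>\<sigma> - 1/4\<close> are negative; the stability condition keeps the radicands nonnegative.
\<close>

definition strong_energy ::
    "(real ^ 'x \<Rightarrow> real ^ 'x \<Rightarrow> real) \<Rightarrow> (real ^ 'x \<Rightarrow> real ^ 'x) \<Rightarrow> real ^ 'x \<Rightarrow> real \<Rightarrow> real \<Rightarrow>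
     (nat \<Rightarrow> real ^ 'x) \<Rightarrow> nat \<Rightarrow> real" where
  "strong_energy ip K \<rho> \<sigma> ht v m =
     sqrt ((mesh_norm ip (sqrt_fun \<rho> * dbar_t ht v m))\<^sup>2
           + (\<sigma> - 1 / 4) * ht\<^sup>2 * (op_norm ip K (dbar_t ht v m))\<^sup>2
           + (op_norm ip K (sbar_t v m))\<^sup>2)"

definition weak_energy ::
    "(real ^ 'x \<Rightarrow> real ^ 'x \<Rightarrow> real) \<Rightarrow> (real ^ 'x \<Rightarrow> real ^ 'x) \<Rightarrow> real ^ 'x \<Rightarrow> real \<Rightarrow> real \<Rightarrow>
     (nat \<Rightarrow> real ^ 'x) \<Rightarrow> nat \<Rightarrow> real" where
  "weak_energy ip K \<rho> \<sigma> ht v m =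
     sqrt ((mesh_norm ip (sqrt_fun \<rho> * v m))\<^sup>2
           + (\<sigma> - 1 / 4) * ht\<^sup>2 * (op_norm ip K (v m))\<^sup>2)"

text \<open>
  A deviation from the source.  In the weak norm, the source claims
  \<open>2 * L1_norm\<close> of $(A_hB_h)^{-1/2}f$ as the $f$-term both for \<open>weak_energy\<close> and for
  $\|I_{h_t}^m \bar s_t v\|_{B_h^{-1}A_h}$.  The second claim is false, because \<open>f 0\<close> enters the scheme
  exactly as \<open>u1 = (ht / 2) f 0\<close>, hence with weight 1/2 rather than 1/4 in \<open>L1_norm\<close>.
  Example: one mesh point, $\rho = A_h = B_h = 1$, $\sigma = 1/4$, $M = 2$, $h_t = 4$,
  $v^0 = u_1 = 0$, $f^0 = 1$, $f^1 = 0$.  Then $v^1 = 8/5$ and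
  $I_{h_t}^1 \bar s_t v = 16/5$, but the claimed bound is 2.  The theorem therefore has the additional
  term $\frac12 h_t \|(A_hB_h)^{-1/2}f^0\|_h$ in the bound of this one quantity, and only there.
\<close>

end

theory Submission
  imports Defs
begin

text \<open>
  The energy method, in a form that serves both norms at once.  Put $K=B_h^{-1}A_h$,
  $R=\rho+(\sigma-\frac14)h_t^2K$ and $F=B_h^{-1}f$.  Since $A_h$ and $B_h$ commute, $K$ is self-adjoint
  and positive, and the stability condition gives $(Rw,w)\ge\varepsilon_0^2\|\sqrt\rho\,w\|_h^2$
  (\<open>R_coercive\<close>).  Moving $\frac14h_t^2K\Lambda_tv$ to the term $Kv$ turns the three-level
  equation into
  \[ R\,\frac{p'-p}{h_t}+K\,\frac{q'+q}2=F,\qquad \frac{q'-q}{h_t}=\frac{p'+p}2, \]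
  a Crank-Nicolson step for the pair $p=\bar\delta_tv$, $q=\bar s_tv$.  Summation of the scheme in time
  gives the same system for $p=v$, $q=I_{h_t}\bar s_tv$, with the accumulated force on the right
  (\<open>summed_scheme\<close>).  The energies $[(Rp,p)+(Kq,q)]^{1/2}$ of these pairs are the strong energy, and
  an upper bound for both weak quantities.

  One estimate carries everything (\<open>Crank_Nicolson_step\<close>).  Write the force as $Ka+g$.  The energy of
  $(p,q-a)$, relative to the equilibrium $a$, grows in one step by at most $h_t$ times the dual norm
  of $g$, which is $\varepsilon_0^{-1}\|\rho^{-1/2}g\|_h$; a move of the equilibrium costs the $K$-norm
  of the move (\<open>Crank_Nicolson_stability\<close>).  The four kinds of bounds differ only in the splitting:
  \<^item> strong norm, $f$ in $L^1$: $a=0$ and $g=F$;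
  \<^item> strong norm, differences of $f$: $g=0$ and $a=A_h^{-1}f$, the potential of $F$;
  \<^item> weak norm, $f$ in $L^1$: $g=0$ and $a$ the potential of the accumulated force;
  \<^item> weak norm, $f=\delta_tg$: $a=A_h^{-1}u_1$ fixed, and the rest of the accumulated force does work.

  The norms with $(A_hB_h)^{-1/2}$ arise because $\|A_h^{-1}w\|_K=\|(A_hB_h)^{-1/2}w\|_h$
  (\<open>dual_norm_eq\<close>).  The square root of a positive self-adjoint operator and its uniqueness come from
  an orthonormal eigenbasis, built from maximisers of Rayleigh quotients; square roots also show that
  products of commuting positive operators are positive.
\<close>

section \<open>Semidefinite symmetric bilinear forms\<close>

locale symmetric_form =
  fixes b :: "'a::real_vector \<Rightarrow> 'a \<Rightarrow> real"
  assumes bilin: "bilinear b" and sym: "b u w = b w u"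
begin

lemmas form_simps =
  bilinear_ladd[OF bilin] bilinear_radd[OF bilin] bilinear_lsub[OF bilin] bilinear_rsub[OF bilin]
  bilinear_lmul[OF bilin] bilinear_rmul[OF bilin] bilinear_lneg[OF bilin] bilinear_rneg[OF bilin]
  bilinear_lzero[OF bilin] bilinear_rzero[OF bilin]

text \<open>
  Semidefiniteness is asked for on \<open>S\<close> only: the form that characterises the maximiser of a
  Rayleigh quotient is semidefinite merely on the invariant subspace over which one maximises.
\<close>

lemma Cauchy_Schwarz_on_subspace:
  assumes S: "subspace S" and nonneg: "\<And>w. w \<in> S \<Longrightarrow> 0 \<le> b w w" and "x \<in> S" "y \<in> S"
  shows "(b x y)\<^sup>2 \<le> b x x * b y y"
proof -
  have quad: "0 \<le> b x x + 2 * t * b x y + t\<^sup>2 * b y y" for t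
  proof -
    have "x + t *\<^sub>R y \<in> S"
      using assms by (simp add: subspace_add subspace_scale)
    from nonneg[OF this] show ?thesis
      using sym[of y x] by (simp add: form_simps algebra_simps power2_eq_square)
  qed
  show ?thesis
  proof (cases "b y y = 0")
    case True
    have "b x y = 0"
    proof (rule ccontr)
      assume "b x y \<noteq> 0"
      with quad[of "- (b x x + 1) / (2 * b x y)"] True show False by (simp add: field_simps)
    qed
    with True show ?thesis by simp
  next
    case False
    with nonneg[OF \<open>y \<in> S\<close>] have "0 < b y y" by simp
    with quad[of "- b x y / b y y"] show ?thesis
      by (simp add: field_simps power2_eq_square)
  qed
qed

end

locale semidefinite_form = symmetric_form +
  assumes nonneg: "0 \<le> b w w"
begin

definition seminorm :: "'a \<Rightarrow> real" where
  "seminorm w = sqrt (b w w)"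

lemma seminorm_nonneg [simp]: "0 \<le> seminorm w"
  by (simp add: seminorm_def nonneg)

lemma seminorm_zero [simp]: "seminorm 0 = 0"
  by (simp add: seminorm_def form_simps)

lemma seminorm_squared: "(seminorm w)\<^sup>2 = b w w"
  by (simp add: seminorm_def nonneg)

lemma seminorm_minus [simp]: "seminorm (- w) = seminorm w"
  by (simp add: seminorm_def form_simps)

lemma seminorm_scale: "seminorm (c *\<^sub>R w) = \<bar>c\<bar> * seminorm w"
proof -
  have "b (c *\<^sub>R w) (c *\<^sub>R w) = c\<^sup>2 * b w w"
    by (simp add: form_simps power2_eq_square)
  then show ?thesis by (simp add: seminorm_def real_sqrt_mult)
qed

lemma Cauchy_Schwarz: "\<bar>b x y\<bar> \<le> seminorm x * seminorm y"
proof (rule power2_le_imp_le)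
  show "\<bar>b x y\<bar>\<^sup>2 \<le> (seminorm x * seminorm y)\<^sup>2"
    using Cauchy_Schwarz_on_subspace[of UNIV x y]
    by (simp add: nonneg power_mult_distrib seminorm_squared)
qed simp

lemma seminorm_triangle: "seminorm (x + y) \<le> seminorm x + seminorm y"
proof (rule power2_le_imp_le)
  have "(seminorm (x + y))\<^sup>2 = (seminorm x)\<^sup>2 + 2 * b x y + (seminorm y)\<^sup>2"
    using sym[of y x] by (simp add: seminorm_squared form_simps)
  also have "\<dots> \<le> (seminorm x + seminorm y)\<^sup>2"
    using Cauchy_Schwarz[of x y] by (simp add: power2_sum)
  finally show "(seminorm (x + y))\<^sup>2 \<le> (seminorm x + seminorm y)\<^sup>2" .
qed simp

end

section \<open>Square roots of positive self-adjoint operators\<close>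

locale inner_form = symmetric_form b for b :: "'a::euclidean_space \<Rightarrow> 'a \<Rightarrow> real" +
  assumes pos: "w \<noteq> 0 \<Longrightarrow> 0 < b w w"
begin

sublocale semidefinite_form b
proof
  show "0 \<le> b w w" for w
    by (cases "w = 0") (auto simp: form_simps intro: less_imp_le pos)
qed

lemma form_eq_zero [simp]: "b w w = 0 \<longleftrightarrow> w = 0"
  using pos[of w] by (cases "w = 0") (auto simp: form_simps)

text \<open>
  A maximiser \<open>e\<close> of the Rayleigh quotient, with maximal value \<open>\<mu>\<close>, is a null vector of the form
  \<open>\<mu> b u w - b (C u) w\<close>, which is semidefinite on \<open>S\<close>; hence the form also vanishes between \<open>e\<close>
  and the residual \<open>\<mu> e - C e\<close>, where it equals the squared norm of that residual.
\<close>

lemma eigenvector_in_invariant_subspace: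
  assumes lin: "linear C" and sa: "\<And>u w. b (C u) w = b u (C w)"
    and S: "subspace S" and inv: "C ` S \<subseteq> S" and "S \<noteq> {0}"
  shows "\<exists>w\<in>S. w \<noteq> 0 \<and> (\<exists>\<mu>. C w = \<mu> *\<^sub>R w)"
proof -
  define X where "X = S \<inter> sphere 0 1"
  define r where "r w = b (C w) w / b w w" for w
  obtain z where z: "z \<in> S" "z \<noteq> 0"
    using \<open>S \<noteq> {0}\<close> subspace_0[OF S] by blast
  have "z /\<^sub>R norm z \<in> X"
    using z S by (simp add: X_def subspace_scale)
  then have "X \<noteq> {}" by blast
  have "compact X"
    unfolding X_def using closed_subspace[OF S] by (intro closed_Int_compact) auto
  have "continuous_on X (\<lambda>w. b (C w) w)" "continuous_on X (\<lambda>w. b w w)"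
    by (intro bilinear_continuous_on_compose[OF _ _ bilin] continuous_on_id linear_continuous_on_compose[OF _ lin])+
  moreover have "\<forall>w\<in>X. b w w \<noteq> 0"
    by (auto simp: X_def)
  ultimately have "continuous_on X r"
    unfolding r_def by (intro continuous_on_divide)
  from continuous_attains_sup[OF \<open>compact X\<close> \<open>X \<noteq> {}\<close> this]
  obtain e where e: "e \<in> X" and max: "\<And>w. w \<in> X \<Longrightarrow> r w \<le> r e" by blast
  define \<mu> where "\<mu> = r e"
  have eS: "e \<in> S" and e0: "e \<noteq> 0" using e by (auto simp: X_def)
  define d where "d u w = \<mu> * b u w - b (C u) w" for u w
  interpret d: symmetric_form d
  proof
    show "bilinear d"
      unfolding d_def bilinear_def
      by (intro conjI allI linearI) (simp_all add: form_simps linear_add[OF lin] linear_scale[OF lin] algebra_simps)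
    show "d u w = d w u" for u w
      using sa[of u w] sym[of u w] sym[of u "C w"] by (simp add: d_def)
  qed
  \<comment> \<open>The Rayleigh quotient is homogeneous of degree zero, so its bound on the sphere extends.\<close>
  have d_nonneg: "0 \<le> d w w" if "w \<in> S" for w
  proof (cases "w = 0")
    case False
    then have "w /\<^sub>R norm w \<in> X"
      using that S by (simp add: X_def subspace_scale)
    from max[OF this] have "r (w /\<^sub>R norm w) \<le> \<mu>" by (simp add: \<mu>_def)
    moreover have "r (w /\<^sub>R norm w) = r w"
      using False by (simp add: r_def form_simps linear_scale[OF lin])
    ultimately show ?thesis
      using pos[OF False] by (simp add: d_def r_def field_simps)
  qed (simp add: d.form_simps)
  have "d e e = 0"
    using pos[OF e0] e0 by (simp add: d_def \<mu>_def r_def)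
  \<comment> \<open>A null vector of the semidefinite form is orthogonal to all of \<open>S\<close>,
    in particular to the residual of the eigenvalue equation.\<close>
  define g where "g = \<mu> *\<^sub>R e - C e"
  have gS: "g \<in> S"
    using S eS inv by (auto simp: g_def intro!: subspace_diff subspace_scale)
  have "(d e g)\<^sup>2 \<le> 0"
    using d.Cauchy_Schwarz_on_subspace[OF S d_nonneg eS gS] \<open>d e e = 0\<close> by simp
  then have "d e g = 0" by simp
  moreover have "d e g = b g g"
    by (simp add: d_def g_def form_simps sa[of e e])
  ultimately have "g = 0" by simp
  then have "C e = \<mu> *\<^sub>R e" by (simp add: g_def)
  then show ?thesis using eS e0 by blast
qed

definition orthonormal_set :: "'a set \<Rightarrow> bool" where
  "orthonormal_set E \<longleftrightarrow> (\<forall>e\<in>E. b e e = 1) \<and> (\<forall>e\<in>E. \<forall>e'\<in>E. e \<noteq> e' \<longrightarrow> b e e' = 0)"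

lemma orthonormal_coefficient:
  assumes "orthonormal_set E" "finite E" "e \<in> E"
  shows "b (\<Sum>x\<in>E. c x *\<^sub>R x) e = c e"
proof -
  interpret l: linear "\<lambda>x. b x e" using bilin by (simp add: bilinear_def)
  have "b (\<Sum>x\<in>E. c x *\<^sub>R x) e = (\<Sum>x\<in>E. if x = e then c x else 0)"
    unfolding l.sum using assms
    by (intro sum.cong) (auto simp: orthonormal_set_def form_simps)
  then show ?thesis using assms by simp
qed

lemma orthonormal_independent:
  assumes E: "orthonormal_set E"
  shows "independent E"
proof (rule ccontr)
  assume "\<not> independent E"
  then obtain T c e where T: "finite T" "T \<subseteq> E" "(\<Sum>x\<in>T. c x *\<^sub>R x) = 0" "e \<in> T" "c e \<noteq> 0"
    unfolding dependent_explicit by blast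
  have "orthonormal_set T" using E T(2) by (auto simp: orthonormal_set_def)
  from orthonormal_coefficient[OF this T(1) T(4), of c] T(3,5) show False
    by (simp add: form_simps)
qed

lemma orthonormal_expansion:
  assumes E: "orthonormal_set E" "finite E" and w: "w \<in> span E"
  shows "w = (\<Sum>e\<in>E. b w e *\<^sub>R e)"
proof -
  obtain c where c: "w = (\<Sum>e\<in>E. c e *\<^sub>R e)"
    using w span_finite[OF E(2)] by auto
  have "b w e = c e" if "e \<in> E" for e
    using orthonormal_coefficient[OF E that] c by simp
  then show ?thesis using c by (simp cong: sum.cong)
qed

text \<open>
  Orthonormal sets of eigenvectors have bounded cardinality, so one of them is largest.  It spans,
  since its orthogonal complement is invariant and would otherwise contain another eigenvector.
\<close>

theorem orthonormal_eigenbasis: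
  assumes lin: "linear C" and sa: "\<And>u w. b (C u) w = b u (C w)"
  shows "\<exists>E. finite E \<and> orthonormal_set E \<and> span E = UNIV \<and> (\<forall>e\<in>E. \<exists>\<mu>. C e = \<mu> *\<^sub>R e)"
proof -
  define P where "P E \<longleftrightarrow> orthonormal_set E \<and> (\<forall>e\<in>E. \<exists>\<mu>. C e = \<mu> *\<^sub>R e)" for E
  have bound: "finite E \<and> card E \<le> DIM('a)" if "P E" for E
    using that orthonormal_independent independent_bound unfolding P_def by blast
  have "P {}" by (simp add: P_def orthonormal_set_def)
  then have "\<exists>E. P E \<and> (\<forall>E'. P E' \<longrightarrow> card E' \<le> card E)"
    using bound by (intro ex_has_greatest_nat[of P "{}" card "DIM('a) + 1"]) (auto simp: less_Suc_eq_le)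
  then obtain E where E: "P E" and max: "\<And>E'. P E' \<Longrightarrow> card E' \<le> card E" by blast
  have fin: "finite E" and on: "orthonormal_set E" and ev: "\<forall>e\<in>E. \<exists>\<mu>. C e = \<mu> *\<^sub>R e"
    using E bound by (auto simp: P_def)
  have "span E = UNIV"
  proof (rule ccontr)
    assume "span E \<noteq> UNIV"
    then obtain x where x: "x \<notin> span E" by blast
    define S where "S = {w. \<forall>e\<in>E. b w e = 0}"
    have "subspace S"
      by (auto simp: S_def subspace_def form_simps)
    moreover have "C ` S \<subseteq> S"
    proof
      fix y assume "y \<in> C ` S"
      then obtain w where w: "w \<in> S" "y = C w" by blast
      have "b (C w) e = 0" if e: "e \<in> E" for e
      proof -
        obtain \<mu> where "C e = \<mu> *\<^sub>R e" using ev e by blast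
        then show ?thesis using w e by (simp add: sa form_simps S_def)
      qed
      then show "y \<in> S" using w by (simp add: S_def)
    qed
    moreover have "S \<noteq> {0}"
    proof -
      define z where "z = x - (\<Sum>e\<in>E. b x e *\<^sub>R e)"
      have "b z e = 0" if "e \<in> E" for e
        using orthonormal_coefficient[OF on fin that, of "b x"] by (simp add: z_def form_simps)
      then have "z \<in> S" by (simp add: S_def)
      moreover have "z \<noteq> 0"
        using x span_sum[of E "\<lambda>e. b x e *\<^sub>R e" E] by (auto simp: z_def span_base span_scale)
      ultimately show ?thesis by blast
    qed
    ultimately obtain w \<mu> where w: "w \<in> S" "w \<noteq> 0" "C w = \<mu> *\<^sub>R w"
      using eigenvector_in_invariant_subspace[OF lin sa] by metis
    define u where "u = (1 / seminorm w) *\<^sub>R w"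
    have sw: "seminorm w \<noteq> 0" "(seminorm w)\<^sup>2 = b w w"
      using w(2) by (simp_all add: seminorm_squared) (simp add: seminorm_def)
    have uu: "b u u = 1"
      using sw w(2) by (simp add: u_def form_simps power2_eq_square[symmetric])
    have uE: "b u e = 0" if "e \<in> E" for e
      using w(1) that by (simp add: u_def form_simps S_def)
    then have Eu: "b e u = 0" if "e \<in> E" for e
      using that by (simp add: sym[of e u])
    have "u \<notin> E" using uu uE by force
    have "C u = \<mu> *\<^sub>R u" using w(3) by (simp add: u_def linear_scale[OF lin])
    then have "P (insert u E)"
      using on ev uu uE Eu by (auto simp: P_def orthonormal_set_def)
    from max[OF this] show False using \<open>u \<notin> E\<close> fin by simp
  qed
  then show ?thesis using fin on ev by blast
qed

end

locale mesh_space =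
  fixes ip :: "real ^ 'x \<Rightarrow> real ^ 'x \<Rightarrow> real"
  assumes mesh: "mesh_inner ip"
begin

sublocale inner_form ip
  using mesh unfolding mesh_inner_def by unfold_locales auto

lemma mult_selfadjoint: "ip (c * u) w = ip u (c * w)"
  using mesh unfolding mesh_inner_def by blast

abbreviation pos_op :: "(real ^ 'x \<Rightarrow> real ^ 'x) \<Rightarrow> bool" where
  "pos_op \<equiv> pos_selfadjoint ip"

lemma pos_op_linear: "pos_op C \<Longrightarrow> linear C"
  by (simp add: pos_selfadjoint_def)

lemma pos_op_selfadjoint: "pos_op C \<Longrightarrow> ip (C u) w = ip u (C w)"
  by (simp add: pos_selfadjoint_def)

lemma pos_op_pos: "pos_op C \<Longrightarrow> w \<noteq> 0 \<Longrightarrow> 0 < ip (C w) w"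
  unfolding pos_selfadjoint_def by blast

lemma pos_op_bij:
  assumes "pos_op C"
  shows "bij C"
proof -
  have lin: "linear C" using assms by (rule pos_op_linear)
  have "inj C"
    unfolding linear_injective_0[OF lin]
    using pos_op_pos[OF assms] by (force simp: form_simps)
  then show ?thesis
    using linear_injective_imp_surjective[OF lin] by (simp add: bij_def)
qed

lemma pos_op_inverse [simp]:
  assumes "pos_op C"
  shows "C (inv C w) = w" "inv C (C w) = w"
  using pos_op_bij[OF assms] by (simp_all add: bij_def surj_f_inv_f)

lemma pos_op_inv:
  assumes "pos_op C"
  shows "pos_op (inv C)"
proof -
  have "linear (inv C)"
    using pos_op_linear[OF assms] pos_op_bij[OF assms]
    by (simp add: inj_linear_imp_inv_linear bij_def)
  moreover have "ip (inv C u) w = ip u (inv C w)" for u w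
    using pos_op_selfadjoint[OF assms, of "inv C u" "inv C w"] assms by simp
  moreover have "0 < ip (inv C w) w" if "w \<noteq> 0" for w
  proof -
    have "inv C w \<noteq> 0"
      using that pos_op_inverse(1)[OF assms, of w] linear_0[OF pos_op_linear[OF assms]] by force
    from pos_op_pos[OF assms this] show ?thesis
      using assms by (simp add: sym[of w "inv C w"])
  qed
  ultimately show ?thesis by (simp add: pos_selfadjoint_def)
qed

text \<open>
  In an orthonormal eigenbasis of \<open>C\<close> with eigenvalues \<open>\<mu> e\<close>, the square root is the diagonal
  operator with entries \<open>sqrt (\<mu> e)\<close>.
\<close>

lemma pos_op_sqrt_exists:
  assumes C: "pos_op C"
  shows "\<exists>S. pos_op S \<and> S \<circ> S = C"
proof -
  have lin: "linear C" using C by (rule pos_op_linear)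
  obtain E where fin: "finite E" and on: "orthonormal_set E" and span: "span E = UNIV"
    and ev: "\<forall>e\<in>E. \<exists>\<mu>. C e = \<mu> *\<^sub>R e"
    using orthonormal_eigenbasis[OF lin pos_op_selfadjoint[OF C]] by blast
  obtain \<mu> where \<mu>: "\<And>e. e \<in> E \<Longrightarrow> C e = \<mu> e *\<^sub>R e"
    using bchoice[OF ev] by blast
  have \<mu>pos: "0 < \<mu> e" if "e \<in> E" for e
  proof -
    have "ip e e = 1" using on that by (simp add: orthonormal_set_def)
    moreover from this have "e \<noteq> 0" by (auto simp: form_simps)
    ultimately show ?thesis
      using pos_op_pos[OF C, of e] \<mu>[OF that] by (simp add: form_simps)
  qed
  define S where "S w = (\<Sum>e\<in>E. (sqrt (\<mu> e) * ip w e) *\<^sub>R e)" for w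
  have linS: "linear S"
    by (rule linearI)
      (simp_all add: S_def form_simps distrib_left scaleR_left_distrib sum.distrib scaleR_sum_right ac_simps)
  have Se: "S e = sqrt (\<mu> e) *\<^sub>R e" if "e \<in> E" for e
  proof -
    have "S e = (\<Sum>x\<in>E. if x = e then sqrt (\<mu> e) *\<^sub>R e else 0)"
      unfolding S_def using on that by (intro sum.cong) (auto simp: orthonormal_set_def)
    then show ?thesis using fin that by simp
  qed
  have form: "ip (S u) w = (\<Sum>e\<in>E. sqrt (\<mu> e) * ip u e * ip w e)" for u w
  proof -
    interpret l: linear "\<lambda>x. ip x w" using bilin by (simp add: bilinear_def)
    show ?thesis
      unfolding S_def l.sum by (intro sum.cong) (auto simp: form_simps intro: sym)
  qed
  have "ip (S u) w = ip u (S w)" for u w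
    unfolding sym[of u "S w"] form by (simp add: ac_simps)
  moreover have "0 < ip (S w) w" if "w \<noteq> 0" for w
  proof -
    have w: "w = (\<Sum>e\<in>E. ip w e *\<^sub>R e)"
      using orthonormal_expansion[OF on fin] span by simp
    have "\<exists>e\<in>E. ip w e \<noteq> 0"
    proof (rule ccontr)
      assume "\<not> ?thesis"
      then have "(\<Sum>e\<in>E. ip w e *\<^sub>R e) = 0" by simp
      with w that show False by simp
    qed
    then obtain e where e: "e \<in> E" "ip w e \<noteq> 0" by blast
    have "0 < (\<Sum>e\<in>E. sqrt (\<mu> e) * (ip w e)\<^sup>2)"
      using e \<mu>pos by (intro sum_pos2[OF fin e(1)]) (auto simp: less_imp_le)
    then show ?thesis by (simp add: form power2_eq_square mult.assoc)
  qed
  moreover have "S (S w) = C w" for w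
  proof (rule linear_eq_on_span[of "\<lambda>w. S (S w)" C E])
    show "linear (\<lambda>w. S (S w))" using linear_compose[OF linS linS] by (simp add: o_def)
    show "S (S e) = C e" if "e \<in> E" for e
      using that \<mu>pos[OF that] by (simp add: Se \<mu> linear_scale[OF linS])
  qed (use lin span in auto)
  ultimately have "pos_op S \<and> S \<circ> S = C"
    using linS by (auto simp: pos_selfadjoint_def)
  then show ?thesis by blast
qed

text \<open>
  From $S^2w=\mu w$ it follows that $S$ maps $r=Sw-\sqrt\mu\,w$ to $-\sqrt\mu\,r$, where $\mu\ge0$;
  this contradicts the positivity of $S$ unless $r=0$.
\<close>

lemma pos_op_sqrt_eigenvector:
  assumes S: "pos_op S" and SS: "S \<circ> S = C" and C: "C w = \<mu> *\<^sub>R w"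
  shows "S w = sqrt \<mu> *\<^sub>R w"
proof (cases "w = 0")
  case True
  then show ?thesis using linear_0[OF pos_op_linear[OF S]] by simp
next
  case False
  have SSw: "S (S w) = \<mu> *\<^sub>R w" using fun_cong[OF SS, of w] C by simp
  have "ip (S (S w)) w = ip (S w) (S w)" by (rule pos_op_selfadjoint[OF S])
  then have "\<mu> * ip w w = ip (S w) (S w)"
    by (simp add: SSw form_simps)
  then have \<mu>: "0 \<le> \<mu>"
    using nonneg[of "S w"] pos[OF False] by (metis zero_le_mult_iff not_less)
  define r where "r = S w - sqrt \<mu> *\<^sub>R w"
  have "S r = - sqrt \<mu> *\<^sub>R r"
    using \<mu> by (simp add: r_def linear_diff[OF pos_op_linear[OF S]]
        linear_scale[OF pos_op_linear[OF S]] SSw scaleR_diff_right)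
  then have "ip (S r) r \<le> 0"
    using \<mu> nonneg[of r] by (simp add: form_simps)
  then have "r = 0" using pos_op_pos[OF S, of r] by force
  then show ?thesis by (simp add: r_def)
qed

text \<open>
  With \<open>T\<close> the identity this is the uniqueness of the square root; with \<open>S = S'\<close> it says that the
  square root commutes with every linear operator that commutes with \<open>C\<close>.  Both hold because a square root is
  determined on the eigenvectors of \<open>C\<close>, and \<open>T\<close> maps eigenvectors to eigenvectors or to zero.
\<close>

lemma pos_op_sqrt_intertwines:
  assumes C: "pos_op C" and S: "pos_op S" "S \<circ> S = C" and S': "pos_op S'" "S' \<circ> S' = C"
    and T: "linear T" "T \<circ> C = C \<circ> T"
  shows "S' (T w) = T (S w)"
proof -
  have lin: "linear C" using C by (rule pos_op_linear)
  obtain E where span: "span E = UNIV" and ev: "\<forall>e\<in>E. \<exists>\<mu>. C e = \<mu> *\<^sub>R e"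
    using orthonormal_eigenbasis[OF lin pos_op_selfadjoint[OF C]] by blast
  show ?thesis
  proof (rule linear_eq_on_span[of "\<lambda>w. S' (T w)" "\<lambda>w. T (S w)" E])
    show "linear (\<lambda>w. S' (T w))"
      using linear_compose[OF T(1) pos_op_linear[OF S'(1)]] unfolding o_def .
    show "linear (\<lambda>w. T (S w))"
      using linear_compose[OF pos_op_linear[OF S(1)] T(1)] unfolding o_def .
    show "S' (T e) = T (S e)" if e: "e \<in> E" for e
    proof -
      obtain \<mu> where \<mu>: "C e = \<mu> *\<^sub>R e" using ev e by blast
      have "C (T e) = T (C e)"
        using fun_cong[OF T(2), of e] by simp
      also have "\<dots> = \<mu> *\<^sub>R T e" by (simp add: \<mu> linear_scale[OF T(1)])
      finally have "C (T e) = \<mu> *\<^sub>R T e" .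
      then have "S' (T e) = sqrt \<mu> *\<^sub>R T e" by (rule pos_op_sqrt_eigenvector[OF S'])
      moreover have "S e = sqrt \<mu> *\<^sub>R e" using \<mu> by (rule pos_op_sqrt_eigenvector[OF S])
      ultimately show ?thesis by (simp add: linear_scale[OF T(1)])
    qed
    show "w \<in> span E" by (simp add: span)
  qed
qed

lemma op_sqrt_props:
  assumes C: "pos_op C"
  shows "pos_op (op_sqrt ip C)" "op_sqrt ip C \<circ> op_sqrt ip C = C"
proof -
  have "\<exists>!S. pos_op S \<and> S \<circ> S = C"
  proof (rule ex_ex1I)
    show "\<exists>S. pos_op S \<and> S \<circ> S = C" using C by (rule pos_op_sqrt_exists)
    show "S = S'" if "pos_op S \<and> S \<circ> S = C" "pos_op S' \<and> S' \<circ> S' = C" for S S'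
    proof
      have "linear id" by (rule linear_id)
      from pos_op_sqrt_intertwines[OF C conjunct1[OF that(2)] conjunct2[OF that(2)]
          conjunct1[OF that(1)] conjunct2[OF that(1)] this]
      show "S w = S' w" for w by simp
    qed
  qed
  from theI'[OF this] show "pos_op (op_sqrt ip C)" "op_sqrt ip C \<circ> op_sqrt ip C = C"
    unfolding op_sqrt_def by blast+
qed

lemma mesh_norm_op_inv_sqrt:
  assumes C: "pos_op C"
  shows "mesh_norm ip (op_inv_sqrt ip C w) = sqrt (ip (inv C w) w)"
proof -
  let ?S = "op_sqrt ip C"
  note S = op_sqrt_props[OF C]
  have "C (inv ?S (inv ?S w)) = ?S (?S (inv ?S (inv ?S w)))"
    using fun_cong[OF S(2)[symmetric]] by (simp only: comp_apply)
  also have "\<dots> = w" using S(1) by simp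
  finally have "inv C w = inv ?S (inv ?S w)"
    using pos_op_inverse(2)[OF C, of "inv ?S (inv ?S w)"] by simp
  then show ?thesis
    unfolding mesh_norm_def op_inv_sqrt_def
    using pos_op_selfadjoint[OF pos_op_inv[OF S(1)], of "inv ?S w" w] by simp
qed

text \<open>
  With $S=B^{1/2}$, which commutes with $A$, the form of $AB$ at $w$ is the form of $A$ at $Sw$.
\<close>

lemma pos_op_comp:
  assumes A: "pos_op A" and B: "pos_op B" and comm: "A \<circ> B = B \<circ> A"
  shows "pos_op (A \<circ> B)"
proof -
  obtain S where S: "pos_op S" "S \<circ> S = B" using pos_op_sqrt_exists[OF B] by blast
  have SS: "S (S w) = B w" for w using fun_cong[OF S(2), of w] by simp
  have AB: "A (B w) = B (A w)" for w using fun_cong[OF comm, of w] by simp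
  have AS: "S (A w) = A (S w)" for w
    using pos_op_sqrt_intertwines[OF B S S pos_op_linear[OF A] comm] .
  have "0 < ip (A (B w)) w" if "w \<noteq> 0" for w
  proof -
    have "S w \<noteq> 0"
      using pos_op_pos[OF S(1) that] by (auto simp: form_simps)
    have "ip (A (B w)) w = ip (S (A (S w))) w"
      by (simp add: AS SS)
    also have "\<dots> = ip (A (S w)) (S w)" by (rule pos_op_selfadjoint[OF S(1)])
    finally show ?thesis using pos_op_pos[OF A \<open>S w \<noteq> 0\<close>] by simp
  qed
  moreover have "ip (A (B u)) w = ip u (A (B w))" for u w
    by (simp add: pos_op_selfadjoint[OF A] pos_op_selfadjoint[OF B] AB[of w])
  ultimately show ?thesis
    using linear_compose[OF pos_op_linear[OF B] pos_op_linear[OF A]]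
    by (simp add: pos_selfadjoint_def)
qed

lemma commute_inv:
  assumes B: "pos_op B" and comm: "A \<circ> B = B \<circ> A"
  shows "A \<circ> inv B = inv B \<circ> A"
proof
  fix w
  have "B (A (inv B w)) = A w"
    using fun_cong[OF comm, of "inv B w"] B by simp
  then show "(A \<circ> inv B) w = (inv B \<circ> A) w"
    using pos_op_inverse(2)[OF B, of "A (inv B w)"] by simp
qed

end

section \<open>Energy bounds for the Crank-Nicolson system\<close>

lemma Cauchy_Schwarz_pair:
  fixes x y :: real
  shows "x * x' + y * y' \<le> sqrt (x\<^sup>2 + y\<^sup>2) * sqrt (x'\<^sup>2 + y'\<^sup>2)"
proof (rule power2_le_imp_le[OF _ mult_nonneg_nonneg])
  have "(x * x' + y * y')\<^sup>2 + (x * y' - y * x')\<^sup>2 = (x\<^sup>2 + y\<^sup>2) * (x'\<^sup>2 + y'\<^sup>2)"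
    by (simp add: power2_eq_square algebra_simps)
  also have "\<dots> = (sqrt (x\<^sup>2 + y\<^sup>2) * sqrt (x'\<^sup>2 + y'\<^sup>2))\<^sup>2"
    by (simp add: power_mult_distrib)
  finally show "(x * x' + y * y')\<^sup>2 \<le> (sqrt (x\<^sup>2 + y\<^sup>2) * sqrt (x'\<^sup>2 + y'\<^sup>2))\<^sup>2"
    using zero_le_power2[of "x * y' - y * x'"] by linarith
qed simp_all

lemma sqrt_sum_squares_shift:
  fixes x y z w :: real
  assumes "0 \<le> x" "x \<le> y + w" "0 \<le> w"
  shows "sqrt (x\<^sup>2 + z\<^sup>2) \<le> sqrt (y\<^sup>2 + z\<^sup>2) + w"
proof -
  have "sqrt (x\<^sup>2 + z\<^sup>2) \<le> sqrt ((y + w)\<^sup>2 + (z + 0)\<^sup>2)"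
    using assms by (simp add: power_mono)
  also have "\<dots> \<le> sqrt (y\<^sup>2 + z\<^sup>2) + sqrt (w\<^sup>2 + 0\<^sup>2)"
    by (rule real_sqrt_sum_squares_triangle_ineq)
  finally show ?thesis using assms by simp
qed

text \<open>
  \<open>R\<close> measures the kinetic and \<open>K\<close> the potential energy.  The number \<open>\<nu> g\<close> is any bound for the
  norm of \<open>g\<close> as a functional on the space with the form of \<open>R\<close>.
\<close>

locale energy_method = symmetric_form ip for ip :: "'a::real_vector \<Rightarrow> 'a \<Rightarrow> real" +
  fixes R K :: "'a \<Rightarrow> 'a" and \<nu> :: "'a \<Rightarrow> real" and h :: real
  assumes linR: "linear R" and linK: "linear K"
    and selfR: "ip (R u) w = ip u (R w)" and selfK: "ip (K u) w = ip u (K w)"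
    and R_nonneg: "0 \<le> ip (R w) w" and K_nonneg: "0 \<le> ip (K w) w"
    and \<nu>_nonneg: "0 \<le> \<nu> g" and \<nu>_zero [simp]: "\<nu> 0 = 0"
    and dual: "ip g w \<le> \<nu> g * sqrt (ip (R w) w)"
    and h_pos: "0 < h"
begin

lemmas op_simps =
  linear_add[OF linR] linear_diff[OF linR] linear_scale[OF linR] linear_0[OF linR]
  linear_add[OF linK] linear_diff[OF linK] linear_scale[OF linK] linear_0[OF linK]

lemma R_sym: "ip (R u) w = ip (R w) u"
  using selfR[of u w] sym[of u "R w"] by simp

lemma K_sym: "ip (K u) w = ip (K w) u"
  using selfK[of u w] sym[of u "K w"] by simp

sublocale K: semidefinite_form "\<lambda>u w. ip (K u) w"
proof
  show "bilinear (\<lambda>u w. ip (K u) w)"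
    unfolding bilinear_def by (intro conjI allI linearI) (simp_all add: form_simps op_simps)
qed (fact K_sym K_nonneg)+

sublocale E: semidefinite_form
  "\<lambda>z z'. ip (R (fst z)) (fst z') + ip (K (snd z)) (snd z')"
proof
  show "bilinear (\<lambda>z z'. ip (R (fst z)) (fst z') + ip (K (snd z)) (snd z'))"
    unfolding bilinear_def
    by (intro conjI allI linearI) (simp_all add: form_simps op_simps algebra_simps)
  show "ip (R (fst z)) (fst z') + ip (K (snd z)) (snd z') =
      ip (R (fst z')) (fst z) + ip (K (snd z')) (snd z)" for z z'
    using R_sym[of "fst z" "fst z'"] K_sym[of "snd z" "snd z'"] by simp
qed (simp add: R_nonneg K_nonneg)

abbreviation energy :: "'a \<Rightarrow> 'a \<Rightarrow> real" where
  "energy p q \<equiv> E.seminorm (p, q)"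

lemma energy_squared: "(energy p q)\<^sup>2 = ip (R p) p + ip (K q) q"
  by (simp add: E.seminorm_squared)

text \<open>
  As the Euclidean norm of a pair of numbers the energy is accessible to \<open>Cauchy_Schwarz_pair\<close> and
  \<open>sqrt_sum_squares_shift\<close>.
\<close>

lemma energy_alt: "energy p q = sqrt ((K.seminorm q)\<^sup>2 + (sqrt (ip (R p) p))\<^sup>2)"
  by (simp add: E.seminorm_def K.seminorm_squared R_nonneg)

lemma velocity_le_energy: "sqrt (ip (R p) p) \<le> energy p q"
  by (simp add: E.seminorm_def K_nonneg)

lemma position_le_energy: "K.seminorm q \<le> energy p q"
  by (simp add: E.seminorm_def K.seminorm_def R_nonneg)

lemma energy_shift: "energy p (q + d) \<le> energy p q + K.seminorm d"
  unfolding energy_alt by (rule sqrt_sum_squares_shift) (simp_all add: K.seminorm_triangle)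

text \<open>
  The force is split into a part \<open>K a\<close>, which is absorbed by measuring the position relative to the
  equilibrium \<open>a\<close>, and a remainder \<open>g\<close>, which does work.  Pairing the force equation with
  \<open>p' + p\<close> and eliminating \<open>p' + p\<close> by the kinematic equation gives the energy identity
  $x^2-y^2=h(g,p'+p)$ for the new energy $x$ and the old energy $y$; its right-hand side is at most
  $h\,\nu(g)\,(x+y)$, and division by $x+y$ leaves the claim.
\<close>

lemma Crank_Nicolson_step:
  assumes force: "R (p' - p) + (h / 2) *\<^sub>R K (q' + q) = h *\<^sub>R (K a + g)"
    and kin: "q' - q = (h / 2) *\<^sub>R (p' + p)"
  shows "energy p' (q' - a) \<le> energy p (q - a) + h * \<nu> g"
proof -
  let ?x = "energy p' (q' - a)" and ?y = "energy p (q - a)" and ?c = "h * \<nu> g"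
  have "ip (R (p' - p) + (h / 2) *\<^sub>R K (q' + q)) (p' + p) = ip (h *\<^sub>R (K a + g)) (p' + p)"
    by (simp only: force)
  then have "ip (R (p' - p)) (p' + p) + ip (K (q' + q)) ((h / 2) *\<^sub>R (p' + p))
      = 2 * ip (K a) ((h / 2) *\<^sub>R (p' + p)) + h * ip g (p' + p)"
    by (simp add: form_simps algebra_simps)
  then have "ip (R (p' - p)) (p' + p) + ip (K (q' + q)) (q' - q)
      = 2 * ip (K a) (q' - q) + h * ip g (p' + p)"
    by (simp only: kin)
  then have id: "?x\<^sup>2 - ?y\<^sup>2 = h * (ip g p' + ip g p)"
    unfolding energy_squared
    using R_sym[of p p'] K_sym[of q q'] K_sym[of q a] K_sym[of q' a]
    by (simp add: form_simps op_simps algebra_simps)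
  have "ip g p' \<le> \<nu> g * ?x" "ip g p \<le> \<nu> g * ?y"
    using dual[of g p'] dual[of g p] velocity_le_energy[of p' "q' - a"] velocity_le_energy[of p "q - a"]
    by (meson \<nu>_nonneg mult_left_mono order_trans)+
  then have "h * (ip g p' + ip g p) \<le> h * (\<nu> g * ?x + \<nu> g * ?y)"
    using h_pos by (intro mult_left_mono) auto
  with id have "(?x - ?y - ?c) * (?x + ?y) \<le> 0"
    by (simp add: power2_eq_square algebra_simps)
  moreover have "0 \<le> ?c" using h_pos \<nu>_nonneg by simp
  ultimately show ?thesis
    using E.seminorm_nonneg[of "(p', q' - a)"] E.seminorm_nonneg[of "(p, q - a)"]
    by (smt (verit) mult_pos_pos)
qed

text \<open>
  The first step is an implicit half-step that starts from the position \<open>q0\<close> with the momentum \<open>u\<close>.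
  Pairing with \<open>p\<close> bounds the squared energy by terms that are linear in the energy; the terms with \<open>q0 - a\<close>
  and \<open>u\<close> are estimated together by Cauchy-Schwarz in the plane, which yields the square root of the
  sum of squares instead of the sum.
\<close>

lemma Crank_Nicolson_half_step:
  assumes force: "R p + (h / 2) *\<^sub>R K q = u + (h / 2) *\<^sub>R (K a + g)"
    and kin: "q - q0 = (h / 2) *\<^sub>R p"
  shows "energy p (q - a) \<le> sqrt ((K.seminorm (q0 - a))\<^sup>2 + (\<nu> u)\<^sup>2) + h / 2 * \<nu> g"
proof -
  let ?x = "energy p (q - a)" and ?Q = "sqrt ((K.seminorm (q0 - a))\<^sup>2 + (\<nu> u)\<^sup>2)"
  let ?r = "sqrt (ip (R p) p)"
  have "ip (R p + (h / 2) *\<^sub>R K q) p = ip (u + (h / 2) *\<^sub>R (K a + g)) p"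
    by (simp only: force)
  then have "ip (R p) p + ip (K q) ((h / 2) *\<^sub>R p)
      = ip u p + ip (K a) ((h / 2) *\<^sub>R p) + h / 2 * ip g p"
    by (simp add: form_simps algebra_simps)
  then have "ip (R p) p + ip (K q) (q - q0) = ip u p + ip (K a) (q - q0) + h / 2 * ip g p"
    by (simp only: kin)
  then have "?x\<^sup>2 = ip (K (q0 - a)) (q - a) + ip u p + h / 2 * ip g p"
    unfolding energy_squared using K_sym[of q a] K_sym[of q q0] K_sym[of q0 a]
    by (simp add: form_simps op_simps algebra_simps)
  also have "\<dots> \<le> (K.seminorm (q0 - a) * K.seminorm (q - a) + \<nu> u * ?r) + h / 2 * (\<nu> g * ?r)"
    using K.Cauchy_Schwarz[of "q0 - a" "q - a"] dual[of u p] mult_left_mono[OF dual[of g p], of "h / 2"] h_pos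
    by linarith
  also have "\<dots> \<le> ?Q * ?x + h / 2 * (\<nu> g * ?x)"
  proof (rule add_mono)
    show "K.seminorm (q0 - a) * K.seminorm (q - a) + \<nu> u * ?r \<le> ?Q * ?x"
      unfolding energy_alt by (rule Cauchy_Schwarz_pair)
    show "h / 2 * (\<nu> g * ?r) \<le> h / 2 * (\<nu> g * ?x)"
      using h_pos \<nu>_nonneg velocity_le_energy by (intro mult_left_mono) auto
  qed
  finally have "?x * ?x \<le> (?Q + h / 2 * \<nu> g) * ?x"
    by (simp add: power2_eq_square algebra_simps)
  moreover have "0 \<le> ?Q + h / 2 * \<nu> g" using h_pos \<nu>_nonneg by simp
  ultimately show ?thesis
    using E.seminorm_nonneg[of "(p, q - a)"] by (cases "?x = 0") auto
qed

text \<open>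
  The equilibrium may move from step to step: each move costs its length in the norm of \<open>K\<close>.
\<close>

lemma Crank_Nicolson_stability:
  assumes "\<And>l. l < n \<Longrightarrow>
      R (p (Suc l) - p l) + (h / 2) *\<^sub>R K (q (Suc l) + q l) = h *\<^sub>R (K (a (Suc l)) + g (Suc l))"
    and "\<And>l. l < n \<Longrightarrow> q (Suc l) - q l = (h / 2) *\<^sub>R (p (Suc l) + p l)"
  shows "energy (p n) (q n - a n) \<le> energy (p 0) (q 0 - a 0)
      + (\<Sum>l = 1..n. K.seminorm (a l - a (l - 1)) + h * \<nu> (g l))"
  using assms
proof (induction n)
  case (Suc n)
  have "energy (p (Suc n)) (q (Suc n) - a (Suc n)) \<le> energy (p n) (q n - a (Suc n)) + h * \<nu> (g (Suc n))"
    using Suc.prems by (intro Crank_Nicolson_step) auto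
  also have "energy (p n) (q n - a (Suc n)) \<le> energy (p n) (q n - a n) + K.seminorm (a (Suc n) - a n)"
    using energy_shift[of "p n" "q n - a n" "- (a (Suc n) - a n)"] by (simp only: K.seminorm_minus) simp
  also have "energy (p n) (q n - a n) \<le> energy (p 0) (q 0 - a 0)
      + (\<Sum>l = 1..n. K.seminorm (a l - a (l - 1)) + h * \<nu> (g l))"
    using Suc by simp
  finally show ?case by simp
qed simp

end

section \<open>The three-level method as a Crank-Nicolson system\<close>

text \<open>
  The coefficient $\sigma$ is replaced by $\frac14$ in the term with \<open>K\<close>, the difference
  $(\sigma-\frac14)h^2K$ being part of \<open>R\<close>.  Then the argument of \<open>K\<close> is the mean of two successive
  values of \<open>sbar_t v\<close>, as it is in the Crank-Nicolson system.
\<close>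

locale three_level = energy_method +
  fixes v F :: "nat \<Rightarrow> 'a" and U :: 'a and M :: nat
  assumes main: "1 \<le> m \<Longrightarrow> m < M \<Longrightarrow>
      R (Lambda_t h v m) + K (v m + (h\<^sup>2 / 4) *\<^sub>R Lambda_t h v m) = F m"
    and initial: "R (d_t h v 0) + K ((h / 2) *\<^sub>R v 0 + (h\<^sup>2 / 4) *\<^sub>R d_t h v 0) = U + (h / 2) *\<^sub>R F 0"
begin

lemma sbar_diff: "sbar_t v (Suc m) - sbar_t v m = (h / 2) *\<^sub>R (dbar_t h v (Suc m) + dbar_t h v m)" if "1 \<le> m"
  using h_pos that by (simp add: sbar_t_def dbar_t_def algebra_simps)

text \<open>
  The increment of \<open>dbar_t h v\<close> is $h\Lambda_tv$, and the mean of two successive values of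
  \<open>sbar_t v\<close> is $v+\frac14h^2\Lambda_tv$.
\<close>

lemma strong_step:
  assumes "1 \<le> m" "m < M"
  shows "R (dbar_t h v (Suc m) - dbar_t h v m) + (h / 2) *\<^sub>R K (sbar_t v (Suc m) + sbar_t v m) = h *\<^sub>R F m"
proof -
  have "dbar_t h v (Suc m) - dbar_t h v m = h *\<^sub>R Lambda_t h v m"
    using h_pos by (simp add: dbar_t_def Lambda_t_def algebra_simps power2_eq_square scaleR_2)
  moreover have "(1 / 2) *\<^sub>R (sbar_t v (Suc m) + sbar_t v m) = v m + (h\<^sup>2 / 4) *\<^sub>R Lambda_t h v m"
  proof -
    have "v m = (1/4) *\<^sub>R v m + (1/4) *\<^sub>R v m + (1/4) *\<^sub>R v m + (1/4) *\<^sub>R v m"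
      by (simp flip: scaleR_left_distrib)
    then show ?thesis
      using h_pos by (simp add: sbar_t_def Lambda_t_def algebra_simps scaleR_2)
  qed
  moreover have "(h / 2) *\<^sub>R K (sbar_t v (Suc m) + sbar_t v m)
      = h *\<^sub>R K ((1 / 2) *\<^sub>R (sbar_t v (Suc m) + sbar_t v m))"
    by (simp add: op_simps scaleR_add_right)
  ultimately show ?thesis
    using main[OF assms] by (simp only: op_simps flip: scaleR_add_right)
qed

lemma initial_half_step:
  "R (dbar_t h v 1) + (h / 2) *\<^sub>R K (sbar_t v 1) = U + (h / 2) *\<^sub>R F 0"
  "sbar_t v 1 - v 0 = (h / 2) *\<^sub>R dbar_t h v 1"
proof -
  have d: "dbar_t h v 1 = d_t h v 0" by (simp add: dbar_t_def d_t_def)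
  have half: "v 0 = (1/2) *\<^sub>R v 0 + (1/2) *\<^sub>R v 0"
    by (simp flip: scaleR_left_distrib)
  show kin: "sbar_t v 1 - v 0 = (h / 2) *\<^sub>R dbar_t h v 1"
    using h_pos by (subst half) (simp add: sbar_t_def dbar_t_def algebra_simps)
  have "(h / 2) *\<^sub>R sbar_t v 1 = (h / 2) *\<^sub>R v 0 + (h\<^sup>2 / 4) *\<^sub>R d_t h v 0"
    using arg_cong[OF kin[unfolded d], of "\<lambda>x. (h / 2) *\<^sub>R x"]
    by (simp add: scaleR_diff_right power2_eq_square algebra_simps)
  then show "R (dbar_t h v 1) + (h / 2) *\<^sub>R K (sbar_t v 1) = U + (h / 2) *\<^sub>R F 0"
    using initial by (simp add: d[simplified] flip: linear_scale[OF linK])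
qed

text \<open>
  The step that leads to the pair of index \<open>m\<close> is driven by \<open>F (m - 1)\<close>, so the energy is
  measured relative to \<open>a (m - 1)\<close>.
\<close>

lemma strong_stability:
  assumes F: "\<And>l. l < M \<Longrightarrow> F l = K (a l) + g l" and m: "1 \<le> m" "m \<le> M"
  shows "energy (dbar_t h v m) (sbar_t v m - a (m - 1))
      \<le> sqrt ((K.seminorm (v 0 - a 0))\<^sup>2 + (\<nu> U)\<^sup>2) + h / 2 * \<nu> (g 0)
        + (\<Sum>l = 1..m - 1. K.seminorm (a l - a (l - 1)) + h * \<nu> (g l))"
proof -
  define p where "p l = dbar_t h v (Suc l)" for l
  define q where "q l = sbar_t v (Suc l)" for l
  have "energy (p (m - 1)) (q (m - 1) - a (m - 1)) \<le> energy (p 0) (q 0 - a 0)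
      + (\<Sum>l = 1..m - 1. K.seminorm (a l - a (l - 1)) + h * \<nu> (g l))"
    using m strong_step F sbar_diff
    by (intro Crank_Nicolson_stability) (simp_all add: p_def q_def)
  moreover have "energy (p 0) (q 0 - a 0)
      \<le> sqrt ((K.seminorm (v 0 - a 0))\<^sup>2 + (\<nu> U)\<^sup>2) + h / 2 * \<nu> (g 0)"
    using initial_half_step m F[of 0] by (intro Crank_Nicolson_half_step) (simp_all add: p_def q_def)
  ultimately show ?thesis using m by (simp add: p_def q_def)
qed

abbreviation primitive :: "nat \<Rightarrow> 'a" where
  "primitive m \<equiv> I_t h m (sbar_t v)"

text \<open>
  The right-hand side of the scheme after summation in time.  The initial equation enters with
  \<open>F 0\<close> at half weight because it is a half-step.
\<close>

definition impulse :: "nat \<Rightarrow> 'a" where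
  "impulse m = U + (h / 2) *\<^sub>R F 0 + h *\<^sub>R (\<Sum>l = 1..<m. F l)"

lemma primitive_Suc: "primitive (Suc m) = primitive m + h *\<^sub>R sbar_t v (Suc m)"
  by (simp add: I_t_def scaleR_add_right)

lemma primitive_0 [simp]: "primitive 0 = 0"
  by (simp add: I_t_def)

text \<open>
  The force equation of the Crank-Nicolson system for the pair of \<open>v\<close> and \<open>primitive\<close>: the steps of
  the strong system telescope, starting from the initial equation.
\<close>

lemma summed_scheme:
  assumes "Suc m \<le> M"
  shows "R (dbar_t h v (Suc m)) + (1 / 2) *\<^sub>R K (primitive (Suc m) + primitive m) = impulse (Suc m)"
  using assms
proof (induction m)
  case 0
  show ?case
    using initial_half_step(1) by (simp add: impulse_def primitive_Suc op_simps)
next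
  case (Suc m)
  have "R (dbar_t h v (Suc (Suc m))) + (1 / 2) *\<^sub>R K (primitive (Suc (Suc m)) + primitive (Suc m))
     = (R (dbar_t h v (Suc m)) + (1 / 2) *\<^sub>R K (primitive (Suc m) + primitive m))
      + (R (dbar_t h v (Suc (Suc m)) - dbar_t h v (Suc m))
        + (h / 2) *\<^sub>R K (sbar_t v (Suc (Suc m)) + sbar_t v (Suc m)))"
    by (simp add: primitive_Suc op_simps algebra_simps)
  also have "\<dots> = impulse (Suc m) + h *\<^sub>R F (Suc m)"
    using Suc strong_step[of "Suc m"] by simp
  also have "\<dots> = impulse (Suc (Suc m))"
    by (simp add: impulse_def scaleR_add_right)
  finally show ?case .
qed

lemma weak_stability:
  assumes \<Phi>: "\<And>l. 1 \<le> l \<Longrightarrow> l \<le> M \<Longrightarrow> impulse l = K (a l) + g l" and m: "m \<le> M"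
  shows "energy (v m) (primitive m - a m) \<le> energy (v 0) (- a 0)
      + (\<Sum>l = 1..m. K.seminorm (a l - a (l - 1)) + h * \<nu> (g l))"
proof -
  have "R (v (Suc l) - v l) + (h / 2) *\<^sub>R K (primitive (Suc l) + primitive l)
      = h *\<^sub>R (K (a (Suc l)) + g (Suc l))" if "l < m" for l
  proof -
    have "v (Suc l) - v l = h *\<^sub>R dbar_t h v (Suc l)"
      using h_pos by (simp add: dbar_t_def)
    then have "R (v (Suc l) - v l) + (h / 2) *\<^sub>R K (primitive (Suc l) + primitive l)
      = h *\<^sub>R (R (dbar_t h v (Suc l)) + (1 / 2) *\<^sub>R K (primitive (Suc l) + primitive l))"
      by (simp only: op_simps scaleR_add_right) simp
    then show ?thesis
      using summed_scheme[of l] \<Phi>[of "Suc l"] that m by simp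
  qed
  moreover have "primitive (Suc l) - primitive l = (h / 2) *\<^sub>R (v (Suc l) + v l)" for l
    by (simp add: primitive_Suc sbar_t_def add.commute)
  ultimately show ?thesis
    using Crank_Nicolson_stability[of m v primitive a g] by simp
qed

text \<open>
  All of the force does work, and the equilibrium stays at zero.
\<close>

theorem strong_bound_dual:
  assumes m: "1 \<le> m" "m \<le> M"
  shows "energy (dbar_t h v m) (sbar_t v m)
      \<le> sqrt ((K.seminorm (v 0))\<^sup>2 + (\<nu> U)\<^sup>2) + (h / 2 * \<nu> (F 0) + h * (\<Sum>l = 1..M - 1. \<nu> (F l)))"
proof -
  have "(\<Sum>l = 1..m - 1. \<nu> (F l)) \<le> (\<Sum>l = 1..M - 1. \<nu> (F l))"
    using m \<nu>_nonneg by (intro sum_mono2) auto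
  from mult_left_mono[OF this, of h]
  show ?thesis
    using strong_stability[of "\<lambda>_. 0" F m] m h_pos by (simp add: op_simps sum_distrib_left)
qed

text \<open>
  None of the force does work: the equilibrium follows the potentials \<open>b l\<close>.  Of the two extremal
  potentials counted by \<open>2 * P\<close>, one comes from the initial displacement from the equilibrium and
  one from passing back to the energy relative to zero.
\<close>

theorem strong_bound_potential:
  assumes F: "\<And>l. l < M \<Longrightarrow> F l = K (b l)" and P: "\<And>l. l < M \<Longrightarrow> K.seminorm (b l) \<le> P"
    and m: "1 \<le> m" "m \<le> M"
  shows "energy (dbar_t h v m) (sbar_t v m)
      \<le> sqrt ((K.seminorm (v 0))\<^sup>2 + (\<nu> U)\<^sup>2)
        + (2 * P + (\<Sum>l = 1..M - 1. K.seminorm (b l - b (l - 1))))"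
proof -
  let ?s = "\<lambda>l. K.seminorm (b l - b (l - 1))"
  have "energy (dbar_t h v m) (sbar_t v m)
      \<le> energy (dbar_t h v m) (sbar_t v m - b (m - 1)) + K.seminorm (b (m - 1))"
    using energy_shift[of _ "sbar_t v m - b (m - 1)" "b (m - 1)"] by simp
  moreover have "K.seminorm (b (m - 1)) \<le> P" "K.seminorm (b 0) \<le> P"
    using P m by auto
  moreover have "energy (dbar_t h v m) (sbar_t v m - b (m - 1))
      \<le> sqrt ((K.seminorm (v 0 - b 0))\<^sup>2 + (\<nu> U)\<^sup>2) + (\<Sum>l = 1..m - 1. ?s l)"
    using strong_stability[of b "\<lambda>_. 0" m] F m by simp
  moreover have "sqrt ((K.seminorm (v 0 - b 0))\<^sup>2 + (\<nu> U)\<^sup>2)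
      \<le> sqrt ((K.seminorm (v 0))\<^sup>2 + (\<nu> U)\<^sup>2) + K.seminorm (b 0)"
    using K.seminorm_triangle[of "v 0" "- b 0"] by (intro sqrt_sum_squares_shift) simp_all
  moreover have "(\<Sum>l = 1..m - 1. ?s l) \<le> (\<Sum>l = 1..M - 1. ?s l)"
    using m by (intro sum_mono2) auto
  ultimately show ?thesis by linarith
qed

text \<open>
  The equilibrium follows the potential of the impulse.  The velocity bound needs only the length of
  the path of the equilibrium; for the primitive, the distance of its last point from zero is added,
  which doubles the contributions of \<open>c\<close> and \<open>b\<close>.
\<close>

lemma
  assumes U: "U = K c" and F: "\<And>l. l < M \<Longrightarrow> F l = K (b l)" and m: "m \<le> M"
  defines "S \<equiv> \<Sum>l = 1..M - 1. K.seminorm (b l)"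
  shows weak_bound_potential: "sqrt (ip (R (v m)) (v m))
      \<le> sqrt (ip (R (v 0)) (v 0)) + K.seminorm c + (h / 2 * K.seminorm (b 0) + h * S)" (is ?velocity)
    and weak_bound_primitive_potential: "K.seminorm (primitive m)
      \<le> sqrt (ip (R (v 0)) (v 0)) + 2 * K.seminorm c + (h * K.seminorm (b 0) + 2 * h * S)" (is ?position)
proof -
  \<comment> \<open>Starting from the equilibrium 0 makes the initial energy that of \<open>v 0\<close> alone.\<close>
  define a where "a l = (if l = 0 then 0 else c + (h / 2) *\<^sub>R b 0 + h *\<^sub>R (\<Sum>j = 1..<l. b j))" for l
  let ?W = "sqrt (ip (R (v 0)) (v 0))"
  let ?Z = "K.seminorm c + (h / 2 * K.seminorm (b 0) + h * S)"
  have imp: "impulse l = K (a l) + 0" if "1 \<le> l" "l \<le> M" for l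
    unfolding impulse_def unfolding U using that by (simp add: a_def F op_simps linear_sum[OF linK])
  have "(\<Sum>l = 1..m. K.seminorm (a l - a (l - 1))) \<le> ?Z \<and> K.seminorm (a m) \<le> (\<Sum>l = 1..m. K.seminorm (a l - a (l - 1)))"
  proof
    have "(\<Sum>l = 1..n. K.seminorm (a l - a (l - 1)))
        \<le> K.seminorm c + (h / 2 * K.seminorm (b 0) + h * (\<Sum>l = 1..n - 1. K.seminorm (b l)))" for n
    proof (induction n)
      case 0
      then show ?case using h_pos by simp
    next
      case (Suc n)
      show ?case
      proof (cases n)
        case 0
        then show ?thesis
          using K.seminorm_triangle[of c "(h / 2) *\<^sub>R b 0"] h_pos
          by (simp add: a_def K.seminorm_scale)
      next
        case (Suc k)
        then have "a (Suc n) - a n = h *\<^sub>R b n"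
          by (simp add: a_def scaleR_add_right)
        then show ?thesis
          using Suc.IH Suc h_pos by (simp add: K.seminorm_scale distrib_left)
      qed
    qed
    from this[of m] have "(\<Sum>l = 1..m. K.seminorm (a l - a (l - 1)))
        \<le> K.seminorm c + (h / 2 * K.seminorm (b 0) + h * (\<Sum>l = 1..m - 1. K.seminorm (b l)))" .
    also have "\<dots> \<le> ?Z"
      unfolding S_def using m h_pos by (intro add_left_mono mult_left_mono sum_mono2) auto
    finally show "(\<Sum>l = 1..m. K.seminorm (a l - a (l - 1))) \<le> ?Z" .
    show "K.seminorm (a m) \<le> (\<Sum>l = 1..m. K.seminorm (a l - a (l - 1)))"
    proof (induction m)
      case 0
      show ?case by (simp add: a_def)
    next
      case (Suc n)
      then show ?case
        using K.seminorm_triangle[of "a n" "a (Suc n) - a n"] by simp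
    qed
  qed
  moreover have "energy (v m) (primitive m - a m) \<le> ?W + (\<Sum>l = 1..m. K.seminorm (a l - a (l - 1)))"
    using weak_stability[OF imp m] by (simp add: a_def E.seminorm_def form_simps op_simps)
  moreover have "K.seminorm (primitive m) \<le> K.seminorm (primitive m - a m) + K.seminorm (a m)"
    using K.seminorm_triangle[of "primitive m - a m" "a m"] by simp
  ultimately show ?velocity ?position
    using velocity_le_energy[of "v m" "primitive m - a m"] position_le_energy[of "primitive m - a m" "v m"]
    by (simp_all add: algebra_simps)
qed

text \<open>
  The impulse telescopes to \<open>U\<close> plus the deviation of \<open>G\<close> from its initial mean.  The
  potential of \<open>U\<close> serves as a fixed equilibrium, and the deviation does work.
\<close>

lemma
  assumes U: "U = K c" and F: "\<And>l. l < M \<Longrightarrow> F l = d_t h G l" and m: "m \<le> M"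
  defines "S \<equiv> \<Sum>l = 1..M. \<nu> (G l - s_t G 0)"
  shows weak_bound_difference: "sqrt (ip (R (v m)) (v m))
      \<le> sqrt (ip (R (v 0)) (v 0)) + K.seminorm c + h * S" (is ?velocity)
    and weak_bound_primitive_difference: "K.seminorm (primitive m)
      \<le> sqrt (ip (R (v 0)) (v 0)) + 2 * K.seminorm c + h * S" (is ?position)
proof -
  have imp: "impulse l = K c + (G l - s_t G 0)" if "1 \<le> l" "l \<le> M" for l
    using that
  proof (induction l rule: nat_induct_at_least)
    case base
    have "(1 / 2) *\<^sub>R G 1 = G 1 - (1 / 2) *\<^sub>R G 1"
      by (simp add: eq_diff_eq flip: scaleR_add_right)
    moreover have "(h / 2) *\<^sub>R F 0 = (1 / 2) *\<^sub>R G 1 - (1 / 2) *\<^sub>R G 0"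
      using F[of 0] base h_pos by (simp add: d_t_def scaleR_diff_right)
    ultimately show ?case
      unfolding impulse_def unfolding U by (simp add: s_t_def scaleR_add_right)
  next
    case (Suc l)
    have "impulse (Suc l) = impulse l + h *\<^sub>R F l"
      using Suc.hyps by (simp add: impulse_def scaleR_add_right)
    moreover have "h *\<^sub>R F l = G (Suc l) - G l"
      using F[of l] Suc.prems h_pos by (simp add: d_t_def)
    ultimately show ?case using Suc by simp
  qed
  have "(\<Sum>l = 1..m. \<nu> (G l - s_t G 0)) \<le> S"
    unfolding S_def using m \<nu>_nonneg by (intro sum_mono2) auto
  from mult_left_mono[OF this, of h]
  have "energy (v m) (primitive m - c) \<le> energy (v 0) (- c) + h * S"
    using weak_stability[OF imp m] h_pos by (simp add: sum_distrib_left)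
  moreover have "energy (v 0) (- c) \<le> sqrt (ip (R (v 0)) (v 0)) + K.seminorm c"
    using energy_shift[of "v 0" 0 "- c"] by (simp add: E.seminorm_def form_simps op_simps)
  moreover have "K.seminorm (primitive m) \<le> K.seminorm (primitive m - c) + K.seminorm c"
    using K.seminorm_triangle[of "primitive m - c" c] by simp
  ultimately show ?velocity ?position
    using velocity_le_energy[of "v m" "primitive m - c"] position_le_energy[of "primitive m - c" "v m"]
    by simp_all
qed

end

lemma Max_image_le:
  fixes F :: "'i \<Rightarrow> 'c::linorder"
  assumes "finite X" "X \<noteq> {}" "\<And>m. m \<in> X \<Longrightarrow> F m \<le> c"
  shows "(MAX m\<in>X. F m) \<le> c"
  using assms by (subst Max_le_iff) auto

section \<open>The method on a mesh with commuting operators\<close>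

context mesh_space
begin

lemma mesh_norm_squared: "(mesh_norm ip w)\<^sup>2 = ip w w"
  by (simp add: mesh_norm_def nonneg)

lemma mesh_norm_nonneg [simp]: "0 \<le> mesh_norm ip w"
  by (simp add: mesh_norm_def nonneg)

lemma op_norm_squared:
  assumes "pos_op C"
  shows "(op_norm ip C w)\<^sup>2 = ip (C w) w"
proof -
  have "0 \<le> ip (C w) w"
    using pos_op_pos[OF assms, of w] by (cases "w = 0") (auto simp: form_simps)
  then show ?thesis by (simp add: op_norm_def)
qed

lemma weighted_norm:
  assumes "\<And>x. 0 \<le> r $ x"
  shows "ip (r * w) w = (mesh_norm ip (sqrt_fun r * w))\<^sup>2"
proof -
  have "r * w = sqrt_fun r * (sqrt_fun r * w)"
    using assms by (simp add: vec_eq_iff sqrt_fun_def flip: mult.assoc)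
  then show ?thesis
    by (simp add: mesh_norm_squared mult_selfadjoint)
qed

text \<open>
  The difference \<open>r - c\<close> is a nonnegative weight, so its form is a squared norm.
\<close>

lemma weighted_norm_lower_bound:
  assumes "\<And>x. c \<le> r $ x"
  shows "c * ip w w \<le> ip (r * w) w"
proof -
  have "ip ((r - (\<chi> x. c)) * w) w = (mesh_norm ip (sqrt_fun (r - (\<chi> x. c)) * w))\<^sup>2"
    using assms by (intro weighted_norm) simp
  moreover have "(r - (\<chi> x. c)) * w = r * w - c *\<^sub>R w"
    by (simp add: vec_eq_iff algebra_simps)
  ultimately have "ip (r * w - c *\<^sub>R w) w = (mesh_norm ip (sqrt_fun (r - (\<chi> x. c)) * w))\<^sup>2"
    by simp
  then have "0 \<le> ip (r * w - c *\<^sub>R w) w"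
    by (simp only: zero_le_power2)
  then show ?thesis by (simp add: form_simps)
qed

lemma weighted_Cauchy_Schwarz:
  assumes "\<And>x. 0 < r $ x"
  shows "ip g w \<le> mesh_norm ip (inv_sqrt_fun r * g) * mesh_norm ip (sqrt_fun r * w)"
proof -
  have "sqrt_fun r * (inv_sqrt_fun r * g) = g"
    using assms by (simp add: vec_eq_iff sqrt_fun_def inv_sqrt_fun_def less_imp_neq[symmetric])
  then have "ip g w = ip (inv_sqrt_fun r * g) (sqrt_fun r * w)"
    by (metis mult_selfadjoint)
  then show ?thesis
    using Cauchy_Schwarz[of "inv_sqrt_fun r * g" "sqrt_fun r * w"]
    by (simp add: mesh_norm_def seminorm_def)
qed

text \<open>
  With $S=B^{-1/2}$, which commutes with $A$ and $B$, the form of $B^{-1}A$ at $w$ is that of $A$ at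
  $Sw$, and the form of $B$ at $Sw$ is $(w,w)$.
\<close>

lemma quotient_operator_bound:
  assumes A: "pos_op A" and B: "pos_op B" and comm: "A \<circ> B = B \<circ> A"
    and bound: "\<And>w. op_norm ip A w \<le> c * op_norm ip B w"
  shows "ip (inv B (A w)) w \<le> c\<^sup>2 * ip w w"
proof -
  have B': "pos_op (inv B)" using B by (rule pos_op_inv)
  obtain S where S: "pos_op S" "S \<circ> S = inv B" using pos_op_sqrt_exists[OF B'] by blast
  have SS: "S (S x) = inv B x" for x using fun_cong[OF S(2), of x] by simp
  have AS: "S (A x) = A (S x)" for x
    using pos_op_sqrt_intertwines[OF B' S S pos_op_linear[OF A] commute_inv[OF B comm]] .
  have "B \<circ> inv B = inv B \<circ> B" using B by auto
  from pos_op_sqrt_intertwines[OF B' S S pos_op_linear[OF B] this]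
  have BS: "S (B x) = B (S x)" for x .
  have "ip (inv B (A w)) w = ip (S (S (A w))) w" by (simp add: SS)
  also have "\<dots> = ip (S (A w)) (S w)" by (rule pos_op_selfadjoint[OF S(1)])
  also have "\<dots> = ip (A (S w)) (S w)" by (simp only: AS)
  also have "\<dots> = (op_norm ip A (S w))\<^sup>2" by (simp add: op_norm_squared A)
  also have "\<dots> \<le> (c * op_norm ip B (S w))\<^sup>2"
  proof (rule power_mono[OF bound])
    show "0 \<le> op_norm ip A (S w)"
      using op_norm_squared[OF A, of "S w"] pos_op_pos[OF A, of "S w"]
      by (cases "S w = 0") (auto simp: op_norm_def form_simps)
  qed
  also have "\<dots> = c\<^sup>2 * ip (B (S w)) (S w)" by (simp add: power_mult_distrib op_norm_squared B)
  also have "ip (B (S w)) (S w) = ip (S (B (S w))) w" by (simp add: pos_op_selfadjoint[OF S(1)])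
  also have "S (B (S w)) = w" using B by (simp add: BS SS)
  finally show ?thesis .
qed

end

text \<open>
  Application of $B^{-1}$ to the scheme gives the form required by \<^locale>\<open>three_level\<close>.
\<close>

locale commuting_method = mesh_space ip
  for ip :: "real ^ 'x \<Rightarrow> real ^ 'x \<Rightarrow> real" +
  fixes A B :: "real ^ 'x \<Rightarrow> real ^ 'x" and \<rho> :: "real ^ 'x" and \<rho>_low \<sigma> \<epsilon> \<alpha> ht :: real
    and M :: nat and v f :: "nat \<Rightarrow> real ^ 'x" and u1 :: "real ^ 'x"
  assumes rho_low: "0 < \<rho>_low" "\<rho>_low \<le> \<rho> $ x"
    and A: "pos_op A" and B: "pos_op B" and comm: "A \<circ> B = B \<circ> A"
    and M_pos: "0 < M" and ht_pos: "0 < ht"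
    and stability: "(1 / 4 \<le> \<sigma> \<and> \<epsilon> = 1) \<or>
         (\<sigma> < 1 / 4 \<and> 0 < \<epsilon> \<and> \<epsilon> < 1 \<and>
          (\<forall>w. op_norm ip A w \<le> \<alpha> * op_norm ip B w) \<and>
          (1 / 4 - \<sigma>) * ht\<^sup>2 * \<alpha>\<^sup>2 \<le> (1 - \<epsilon>\<^sup>2) * \<rho>_low)"
    and scheme: "three_level_method A B \<rho> \<sigma> ht M f u1 v"
begin

definition K :: "real ^ 'x \<Rightarrow> real ^ 'x" where "K = inv B \<circ> A"

definition R :: "real ^ 'x \<Rightarrow> real ^ 'x" where
  "R w = \<rho> * w + ((\<sigma> - 1 / 4) * ht\<^sup>2) *\<^sub>R K w"

definition \<nu> :: "real ^ 'x \<Rightarrow> real" where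
  "\<nu> g = 1 / \<epsilon> * mesh_norm ip (inv_sqrt_fun \<rho> * g)"

lemma eps_pos: "0 < \<epsilon>"
  using stability by auto

lemma rho_pos: "0 < \<rho> $ x"
  using rho_low by (rule less_le_trans)

lemma K_pos_op: "pos_op K"
  unfolding K_def
  using pos_op_inv[OF B] A commute_inv[OF B comm, symmetric] by (rule pos_op_comp)

lemma K_linear: "linear K"
  using K_pos_op by (rule pos_op_linear)

lemma K_form_nonneg: "0 \<le> ip (K w) w"
  using op_norm_squared[OF K_pos_op, of w] by (metis zero_le_power2)

lemma R_form: "ip (R w) w = (mesh_norm ip (sqrt_fun \<rho> * w))\<^sup>2 + (\<sigma> - 1 / 4) * ht\<^sup>2 * (op_norm ip K w)\<^sup>2"
  using weighted_norm[of \<rho> w] rho_pos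
  by (simp add: R_def form_simps op_norm_squared[OF K_pos_op] less_imp_le)

text \<open>
  This is the purpose of the stability condition: the negative part of \<open>R\<close> consumes at most the
  fraction $1-\varepsilon^2$ of the squared weighted norm.
\<close>

lemma R_coercive: "(\<epsilon> * mesh_norm ip (sqrt_fun \<rho> * w))\<^sup>2 \<le> ip (R w) w"
proof -
  let ?m = "(mesh_norm ip (sqrt_fun \<rho> * w))\<^sup>2"
  have m: "ip (\<rho> * w) w = ?m"
    using rho_pos by (intro weighted_norm) (simp add: less_imp_le)
  show ?thesis
    using stability
  proof
    assume "1 / 4 \<le> \<sigma> \<and> \<epsilon> = 1"
    then show ?thesis by (simp add: R_form)
  next
    assume *: "\<sigma> < 1 / 4 \<and> 0 < \<epsilon> \<and> \<epsilon> < 1 \<and>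
          (\<forall>w. op_norm ip A w \<le> \<alpha> * op_norm ip B w) \<and>
          (1 / 4 - \<sigma>) * ht\<^sup>2 * \<alpha>\<^sup>2 \<le> (1 - \<epsilon>\<^sup>2) * \<rho>_low"
    have "ip (K w) w \<le> \<alpha>\<^sup>2 * ip w w"
      using quotient_operator_bound[OF A B comm, of \<alpha> w] * by (simp add: K_def)
    then have "(1 / 4 - \<sigma>) * ht\<^sup>2 * ip (K w) w \<le> (1 / 4 - \<sigma>) * ht\<^sup>2 * (\<alpha>\<^sup>2 * ip w w)"
      using * by (intro mult_left_mono) auto
    also have "\<dots> = ((1 / 4 - \<sigma>) * ht\<^sup>2 * \<alpha>\<^sup>2) * ip w w" by simp
    also have "\<dots> \<le> ((1 - \<epsilon>\<^sup>2) * \<rho>_low) * ip w w"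
      using * nonneg by (intro mult_right_mono) auto
    also have "\<dots> = (1 - \<epsilon>\<^sup>2) * (\<rho>_low * ip w w)" by simp
    also have "\<dots> \<le> (1 - \<epsilon>\<^sup>2) * ?m"
      using * weighted_norm_lower_bound[of \<rho>_low \<rho> w] rho_low
      unfolding m by (intro mult_left_mono) (auto simp: power_le_one)
    finally show ?thesis
      by (simp add: R_form op_norm_squared[OF K_pos_op] power_mult_distrib algebra_simps)
  qed
qed

sublocale three_level ip R K \<nu> ht v "\<lambda>m. inv B (f m)" "inv B u1" M
proof (intro three_level.intro energy_method.intro energy_method_axioms.intro three_level_axioms.intro)
  show "symmetric_form ip" by unfold_locales
  show "linear R"
    by (rule linearI) (simp_all add: R_def linear_add[OF K_linear] linear_scale[OF K_linear] algebra_simps)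
  show "linear K" by (rule K_linear)
  show selfK: "ip (K u) w = ip u (K w)" for u w by (rule pos_op_selfadjoint[OF K_pos_op])
  show "ip (R u) w = ip u (R w)" for u w
    by (simp add: R_def form_simps selfK mult_selfadjoint)
  show "0 \<le> ip (R w) w" for w using R_coercive[of w] by (meson order_trans zero_le_power2)
  show "0 \<le> ip (K w) w" for w by (rule K_form_nonneg)
  show "0 \<le> \<nu> g" for g using eps_pos by (simp add: \<nu>_def)
  show "\<nu> 0 = 0" by (simp add: \<nu>_def mesh_norm_def form_simps)
  show "0 < ht" by (rule ht_pos)
  show "ip g w \<le> \<nu> g * sqrt (ip (R w) w)" for g w
  proof -
    have "ip g w \<le> mesh_norm ip (inv_sqrt_fun \<rho> * g) * mesh_norm ip (sqrt_fun \<rho> * w)"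
      using rho_pos by (rule weighted_Cauchy_Schwarz)
    also have "\<dots> = \<nu> g * (\<epsilon> * mesh_norm ip (sqrt_fun \<rho> * w))"
      using eps_pos by (simp add: \<nu>_def)
    also have "\<dots> \<le> \<nu> g * sqrt (ip (R w) w)"
      using eps_pos by (intro mult_left_mono real_le_rsqrt R_coercive) (simp add: \<nu>_def)
    finally show ?thesis .
  qed
  have invB: "inv B (B x + y) = x + inv B y" for x y
    using B linear_add[OF pos_op_linear[OF pos_op_inv[OF B]]] by simp
  note lin = linear_add[OF pos_op_linear[OF pos_op_inv[OF B]]]
    linear_scale[OF pos_op_linear[OF pos_op_inv[OF B]]]
    linear_add[OF K_linear] linear_scale[OF K_linear]
  have K: "inv B (A x) = K x" for x by (simp add: K_def)
  show "R (Lambda_t ht v m) + K (v m + (ht\<^sup>2 / 4) *\<^sub>R Lambda_t ht v m) = inv B (f m)"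
    if "1 \<le> m" "m < M" for m
  proof -
    have "B (\<rho> * Lambda_t ht v m) + ((\<sigma> * ht\<^sup>2) *\<^sub>R A (Lambda_t ht v m) + A (v m)) = f m"
      using scheme that by (simp add: three_level_method_def add.assoc)
    then have "inv B (B (\<rho> * Lambda_t ht v m) + ((\<sigma> * ht\<^sup>2) *\<^sub>R A (Lambda_t ht v m) + A (v m))) = inv B (f m)"
      by simp
    then show ?thesis
      unfolding invB by (simp add: lin K R_def algebra_simps)
  qed
  show "R (d_t ht v 0) + K ((ht / 2) *\<^sub>R v 0 + (ht\<^sup>2 / 4) *\<^sub>R d_t ht v 0) = inv B u1 + (ht / 2) *\<^sub>R inv B (f 0)"
  proof -
    have "B (\<rho> * d_t ht v 0) + ((\<sigma> * ht\<^sup>2) *\<^sub>R A (d_t ht v 0) + (ht / 2) *\<^sub>R A (v 0)) = u1 + (ht / 2) *\<^sub>R f 0"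
      using scheme by (simp add: three_level_method_def add.assoc)
    then have "inv B (B (\<rho> * d_t ht v 0) + ((\<sigma> * ht\<^sup>2) *\<^sub>R A (d_t ht v 0) + (ht / 2) *\<^sub>R A (v 0)))
        = inv B (u1 + (ht / 2) *\<^sub>R f 0)"
      by simp
    then show ?thesis
      unfolding invB by (simp add: lin K R_def algebra_simps)
  qed
qed

lemma op_norm_K: "op_norm ip K w = K.seminorm w"
  by (simp add: op_norm_def K.seminorm_def)

lemma strong_energy_eq: "strong_energy ip K \<rho> \<sigma> ht v m = energy (dbar_t ht v m) (sbar_t v m)"
  by (simp add: strong_energy_def E.seminorm_def R_form op_norm_squared[OF K_pos_op])

lemma weak_energy_eq: "weak_energy ip K \<rho> \<sigma> ht v m = sqrt (ip (R (v m)) (v m))"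
  by (simp add: weak_energy_def R_form)

text \<open>
  The norm of $(AB)^{-1/2}w$ is the \<open>K\<close>-norm of the potential $A^{-1}w$ of the force $B^{-1}w$,
  since both squares are equal to $(A^{-1}B^{-1}w,w)$.
\<close>

lemma dual_norm_eq: "mesh_norm ip (op_inv_sqrt ip (A \<circ> B) w) = K.seminorm (inv A w)"
proof -
  have AB: "pos_op (A \<circ> B)" using A B comm by (rule pos_op_comp)
  have "(A \<circ> B) (inv A (inv B w)) = w"
    using A B by (simp add: comm)
  then have "inv (A \<circ> B) w = inv A (inv B w)"
    using pos_op_inverse(2)[OF AB, of "inv A (inv B w)"] by simp
  moreover have "ip (inv A (inv B w)) w = ip (K (inv A w)) (inv A w)"
    using A by (simp add: K_def pos_op_selfadjoint[OF pos_op_inv[OF A]])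
  ultimately show ?thesis
    by (simp add: mesh_norm_op_inv_sqrt[OF AB] K.seminorm_def)
qed

lemma K_potential: "inv B w = K (inv A w)"
  using A by (simp add: K_def)

lemma initial_data_norm:
  "sqrt ((op_norm ip K (v 0))\<^sup>2 + (1 / \<epsilon>\<^sup>2) * (mesh_norm ip (inv_sqrt_fun \<rho> * inv B u1))\<^sup>2)
    = sqrt ((K.seminorm (v 0))\<^sup>2 + (\<nu> (inv B u1))\<^sup>2)"
  by (simp add: op_norm_K \<nu>_def power_mult_distrib power_divide)

lemma strong_bound_L1:
  assumes "1 \<le> m" "m \<le> M"
  shows "strong_energy ip K \<rho> \<sigma> ht v m
    \<le> sqrt ((op_norm ip K (v 0))\<^sup>2 + (1 / \<epsilon>\<^sup>2) * (mesh_norm ip (inv_sqrt_fun \<rho> * inv B u1))\<^sup>2)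
      + 2 / \<epsilon> * L1_norm ip ht M (\<lambda>m. inv_sqrt_fun \<rho> * inv B (f m))"
proof -
  let ?n = "\<lambda>l. mesh_norm ip (inv_sqrt_fun \<rho> * inv B (f l))"
  have "ht / 2 * \<nu> (inv B (f 0)) + ht * (\<Sum>l = 1..M - 1. \<nu> (inv B (f l)))
      = 1 / \<epsilon> * (ht / 2 * ?n 0 + ht * (\<Sum>l = 1..M - 1. ?n l))"
    unfolding \<nu>_def sum_distrib_left[symmetric] by (simp add: algebra_simps)
  also have "\<dots> \<le> 1 / \<epsilon> * (2 * (1 / 4 * ht * ?n 0 + ht * (\<Sum>l = 1..M - 1. ?n l)))"
    using eps_pos ht_pos by (intro mult_left_mono) (auto simp: sum_nonneg)
  also have "\<dots> = 2 / \<epsilon> * L1_norm ip ht M (\<lambda>m. inv_sqrt_fun \<rho> * inv B (f m))"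
    by (simp add: L1_norm_def I_t_def)
  finally show ?thesis
    using strong_bound_dual[OF assms] unfolding strong_energy_eq initial_data_norm by linarith
qed

lemma strong_bound_dbar:
  assumes "1 \<le> m" "m \<le> M"
  shows "strong_energy ip K \<rho> \<sigma> ht v m
    \<le> sqrt ((op_norm ip K (v 0))\<^sup>2 + (1 / \<epsilon>\<^sup>2) * (mesh_norm ip (inv_sqrt_fun \<rho> * inv B u1))\<^sup>2)
      + (2 * I_t ht (M - 1) (\<lambda>m. mesh_norm ip (op_inv_sqrt ip (A \<circ> B) (dbar_t ht f m)))
            + 3 * (MAX m\<in>{0..M - 1}. mesh_norm ip (op_inv_sqrt ip (A \<circ> B) (f m))))"
proof -
  define P where "P = (MAX m\<in>{0..M - 1}. K.seminorm (inv A (f m)))"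
  define S where "S = (\<Sum>l = 1..M - 1. K.seminorm (inv A (f l) - inv A (f (l - 1))))"
  have P: "K.seminorm (inv A (f l)) \<le> P" if "l < M" for l
    unfolding P_def using that by (intro Max_ge) auto
  have "0 \<le> P" using P[OF M_pos] K.seminorm_nonneg order_trans by blast
  have "0 \<le> S" by (simp add: S_def sum_nonneg)
  have linA: "linear (inv A)" by (rule pos_op_linear[OF pos_op_inv[OF A]])
  have "K.seminorm (inv A (dbar_t ht f l)) = 1 / ht * K.seminorm (inv A (f l) - inv A (f (l - 1)))" for l
    using ht_pos by (simp add: dbar_t_def linear_scale[OF linA] linear_diff[OF linA] K.seminorm_scale)
  then have I: "I_t ht (M - 1) (\<lambda>m. K.seminorm (inv A (dbar_t ht f m))) = S"
    using ht_pos by (simp add: I_t_def S_def flip: sum_divide_distrib)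
  show ?thesis
    using strong_bound_potential[OF K_potential P assms, folded S_def] \<open>0 \<le> P\<close> \<open>0 \<le> S\<close>
    unfolding strong_energy_eq initial_data_norm dual_norm_eq I P_def[symmetric] by linarith
qed

lemma
  assumes "m \<le> M"
  shows weak_bound_L1: "weak_energy ip K \<rho> \<sigma> ht v m
      \<le> weak_energy ip K \<rho> \<sigma> ht v 0 + 2 * mesh_norm ip (op_inv_sqrt ip (A \<circ> B) u1)
        + 2 * L1_norm ip ht M (\<lambda>m. op_inv_sqrt ip (A \<circ> B) (f m))" (is ?velocity)
    and weak_bound_primitive_L1: "op_norm ip K (I_t ht m (sbar_t v))
      \<le> weak_energy ip K \<rho> \<sigma> ht v 0 + 2 * mesh_norm ip (op_inv_sqrt ip (A \<circ> B) u1)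
        + (2 * L1_norm ip ht M (\<lambda>m. op_inv_sqrt ip (A \<circ> B) (f m))
          + 1 / 2 * ht * mesh_norm ip (op_inv_sqrt ip (A \<circ> B) (f 0)))" (is ?position)
proof -
  define S where "S = (\<Sum>l = 1..M - 1. K.seminorm (inv A (f l)))"
  have L1: "L1_norm ip ht M (\<lambda>m. op_inv_sqrt ip (A \<circ> B) (f m)) = 1 / 4 * ht * K.seminorm (inv A (f 0)) + ht * S"
    by (simp add: L1_norm_def I_t_def dual_norm_eq S_def)
  have "0 \<le> ht * S"
    using ht_pos by (simp add: S_def sum_nonneg)
  moreover have "0 \<le> K.seminorm (inv A u1)" by simp
  ultimately show ?velocity ?position
    using weak_bound_potential[OF K_potential K_potential assms, folded S_def]
      weak_bound_primitive_potential[OF K_potential K_potential assms, folded S_def]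
    unfolding weak_energy_eq L1 op_norm_K dual_norm_eq by argo+
qed

lemma weak_bound_difference_force:
  assumes g: "\<And>l. l < M \<Longrightarrow> f l = d_t ht g l" and "m \<le> M"
  shows "max (weak_energy ip K \<rho> \<sigma> ht v m) (op_norm ip K (I_t ht m (sbar_t v)))
      \<le> weak_energy ip K \<rho> \<sigma> ht v 0 + 2 * mesh_norm ip (op_inv_sqrt ip (A \<circ> B) u1)
        + 2 / \<epsilon> * I_t ht M (\<lambda>m. mesh_norm ip (inv_sqrt_fun \<rho> * inv B (g m - s_t g 0)))"
proof -
  let ?G = "\<lambda>l. inv B (g l)"
  define S where "S = (\<Sum>l = 1..M. \<nu> (?G l - s_t ?G 0))"
  have linB: "linear (inv B)" by (rule pos_op_linear[OF pos_op_inv[OF B]])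
  have G: "inv B (f l) = d_t ht ?G l" if "l < M" for l
    using g[OF that] by (simp add: d_t_def linear_scale[OF linB] linear_diff[OF linB])
  have "?G l - s_t ?G 0 = inv B (g l - s_t g 0)" for l
    by (simp add: s_t_def linear_scale[OF linB] linear_diff[OF linB] linear_add[OF linB])
  then have "S = 1 / \<epsilon> * (\<Sum>l = 1..M. mesh_norm ip (inv_sqrt_fun \<rho> * inv B (g l - s_t g 0)))"
    unfolding S_def \<nu>_def by (simp add: sum_divide_distrib)
  then have I: "2 / \<epsilon> * I_t ht M (\<lambda>m. mesh_norm ip (inv_sqrt_fun \<rho> * inv B (g m - s_t g 0))) = 2 * (ht * S)"
    by (simp add: I_t_def)
  have "0 \<le> ht * S"
    using ht_pos \<nu>_nonneg by (simp add: S_def sum_nonneg)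
  moreover have "0 \<le> K.seminorm (inv A u1)" by simp
  ultimately show ?thesis
    using weak_bound_difference[OF K_potential G assms(2), folded S_def]
      weak_bound_primitive_difference[OF K_potential G assms(2), folded S_def]
    unfolding weak_energy_eq I op_norm_K dual_norm_eq by (intro max.boundedI; linarith)
qed

end

theorem theorem1:
  fixes ip :: "real ^ 'x \<Rightarrow> real ^ 'x \<Rightarrow> real"
    and A B :: "real ^ 'x \<Rightarrow> real ^ 'x"
    and \<rho> :: "real ^ 'x"
    and \<rho>_low \<sigma> \<epsilon> \<alpha> T ht :: real
    and M :: nat
    and v f :: "nat \<Rightarrow> real ^ 'x"
    and u1 :: "real ^ 'x"
  assumes "mesh_inner ip"
    and "0 < \<rho>_low" and "\<forall>x. \<rho>_low \<le> \<rho> $ x"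
    and "pos_selfadjoint ip A" and "pos_selfadjoint ip B"
    and "A \<circ> B = B \<circ> A"
    and "0 < T" and "2 \<le> M" and "ht = T / real M"
    and "(1 / 4 \<le> \<sigma> \<and> \<epsilon> = 1) \<or>
         (\<sigma> < 1 / 4 \<and> 0 < \<epsilon> \<and> \<epsilon> < 1 \<and>
          (\<forall>w. op_norm ip A w \<le> \<alpha> * op_norm ip B w) \<and>
          (1 / 4 - \<sigma>) * ht\<^sup>2 * \<alpha>\<^sup>2 \<le> (1 - \<epsilon>\<^sup>2) * \<rho>_low)"
    and "three_level_method A B \<rho> \<sigma> ht M f u1 v"
  shows "(MAX m\<in>{1..M}. strong_energy ip (inv B \<circ> A) \<rho> \<sigma> ht v m)
       \<le> sqrt ((op_norm ip (inv B \<circ> A) (v 0))\<^sup>2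
               + (1 / \<epsilon>\<^sup>2) * (mesh_norm ip (inv_sqrt_fun \<rho> * inv B u1))\<^sup>2)
         + 2 / \<epsilon> * L1_norm ip ht M (\<lambda>m. inv_sqrt_fun \<rho> * inv B (f m)) \<and>
     (MAX m\<in>{1..M}. strong_energy ip (inv B \<circ> A) \<rho> \<sigma> ht v m)
       \<le> sqrt ((op_norm ip (inv B \<circ> A) (v 0))\<^sup>2
               + (1 / \<epsilon>\<^sup>2) * (mesh_norm ip (inv_sqrt_fun \<rho> * inv B u1))\<^sup>2)
         + (2 * I_t ht (M - 1) (\<lambda>m. mesh_norm ip (op_inv_sqrt ip (A \<circ> B) (dbar_t ht f m)))
            + 3 * (MAX m\<in>{0..M - 1}. mesh_norm ip (op_inv_sqrt ip (A \<circ> B) (f m)))) \<and>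
     (MAX m\<in>{0..M}. weak_energy ip (inv B \<circ> A) \<rho> \<sigma> ht v m)
       \<le> weak_energy ip (inv B \<circ> A) \<rho> \<sigma> ht v 0 + 2 * mesh_norm ip (op_inv_sqrt ip (A \<circ> B) u1)
         + 2 * L1_norm ip ht M (\<lambda>m. op_inv_sqrt ip (A \<circ> B) (f m)) \<and>
     (MAX m\<in>{0..M}. op_norm ip (inv B \<circ> A) (I_t ht m (sbar_t v)))
       \<le> weak_energy ip (inv B \<circ> A) \<rho> \<sigma> ht v 0 + 2 * mesh_norm ip (op_inv_sqrt ip (A \<circ> B) u1)
         + (2 * L1_norm ip ht M (\<lambda>m. op_inv_sqrt ip (A \<circ> B) (f m))
            + 1 / 2 * ht * mesh_norm ip (op_inv_sqrt ip (A \<circ> B) (f 0))) \<and>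
     (\<forall>g. (\<forall>m\<in>{0..M - 1}. f m = d_t ht g m) \<longrightarrow>
       (MAX m\<in>{0..M}. max (weak_energy ip (inv B \<circ> A) \<rho> \<sigma> ht v m)
                      (op_norm ip (inv B \<circ> A) (I_t ht m (sbar_t v))))
       \<le> weak_energy ip (inv B \<circ> A) \<rho> \<sigma> ht v 0 + 2 * mesh_norm ip (op_inv_sqrt ip (A \<circ> B) u1)
         + 2 / \<epsilon> * I_t ht M (\<lambda>m. mesh_norm ip (inv_sqrt_fun \<rho> * inv B (g m - s_t g 0))))"
proof -
  interpret commuting_method ip A B \<rho> \<rho>_low \<sigma> \<epsilon> \<alpha> ht M v f u1
    using assms by unfold_locales auto
  have "1 \<le> M" using \<open>2 \<le> M\<close> by simp
  show ?thesis
    unfolding K_def[symmetric]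
    apply (intro conjI allI impI)
    subgoal by (rule Max_image_le; (rule strong_bound_L1)?) (use \<open>1 \<le> M\<close> in auto)
    subgoal by (rule Max_image_le; (rule strong_bound_dbar)?) (use \<open>1 \<le> M\<close> in auto)
    subgoal by (rule Max_image_le; (rule weak_bound_L1)?) auto
    subgoal by (rule Max_image_le; (rule weak_bound_primitive_L1)?) auto
    subgoal by (rule Max_image_le; (rule weak_bound_difference_force)?) auto
    done
qed

end
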